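(* Let $R_1=\{(0,0),(0,1),(0,2),(0,3),(1,1),(1,3),(2,1),(2,2),(2,3),(3,3)\}$, $R_2=\{(0,0),(0,1),(0,2),(0,3),(1,1),(2,1),(2,2),(2,3),(3,1),(3,3)\}$, $R_3=\{(0,0),(0,1),(0,2),(0,3),(1,1),(1,2),(1,3),(2,2),(3,2),(3,3)\}$, $R_4=\{(0,0),(0,1),(0,2),(0,3),(1,1),(1,2),(2,2),(3,1),(3,2),(3,3)\}$, $R_5=\{(0,0),(1,0),(2,0),(3,0),(1,1),(1,2),(2,2),(3,1),(3,2),(3,3)\}$, $R_6=\{(0,0),(1,0),(2,0),(3,0),(1,1),(1,2),(1,3),(2,2),(3,2),(3,3)\}$, $R_7=\{(0,0),(1,0),(2,0),(3,0),(1,1),(2,1),(2,2),(2,3),(3,1),(3,3)\}$, $R_8=\{(0,0),(1,0),(2,0),(3,0),(1,1),(1,3),(2,1),(2,2),(2,3),(3,3)\}$. Then $(123,R_j)\sim_{jd}(132,R_j)$ for each $j\in\{1,\dots,8\}$. Moreover, any two of the eight pairs $\{(123,R_j),(132,R_j)\}$ have the same joint distribution.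
   Context: $S_n$ is the set of permutations $\pi=\pi_1\cdots\pi_n$ of $\{1,\dots,n\}$. A mesh pattern of length $k$ is a pair $(\tau,R)$ with $\tau\in S_k$ and $R\subseteq\{0,\dots,k\}\times\{0,\dots,k\}$ (the set of shaded boxes; box $(a,b)$ is the unit square with lower-left corner $(a,b)$). An occurrence of $(\tau,R)$ in $\pi\in S_n$ is a subsequence $\pi_{i_1}\cdots\pi_{i_k}$, $i_1<\dots<i_k$, order-isomorphic to $\tau$, such that, with $i_0=0$, $i_{k+1}=n+1$, with $v_1<\dots<v_k$ the values $\pi_{i_1},\dots,\pi_{i_k}$ in increasing order, and $v_0=0$, $v_{k+1}=n+1$, for each $(a,b)\in R$ there is no index $m$ with $i_a<m<i_{a+1}$ and $v_b<\pi_m<v_{b+1}$. Two mesh patterns $q_1,q_2$ are jointly equidistributed, written $q_1\sim_{jd}q_2$, if for all nonnegative integers $n,k,\ell$ the number of $\pi\in S_n$ with exactly $k$ occurrences of $q_1$ and $\ell$ occurrences of $q_2$ equals the number of $\pi\in S_n$ with exactly $\ell$ occurrences of $q_1$ and $k$ occurrences of $q_2$. The joint distribution of a pair $\{q_1,q_2\}$ (with $q_1$ having underlying permutation $123$ and $q_2$ having underlying permutation $132$) is the family of numbers $T_{n,k,\ell}$ of $\pi\in S_n$ with exactly $k$ occurrences of $q_1$ and $\ell$ occurrences of $q_2$; two pairs have the same joint distribution if these numbers agree for all $n,k,\ell$. *)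

theory Defs
  imports "HOL-Combinatorics.Multiset_Permutations"
begin

text \<open>
  Permutations are lists in one-line notation. Positions and values are both counted from 1, so the
  entry in position \<open>i\<close> of \<open>\<pi>\<close> is \<open>\<pi> ! (i - 1)\<close>.
\<close>

definition S :: "nat \<Rightarrow> nat list set" where
  "S n = permutations_of_set {1..n}"

definition entry :: "nat list \<Rightarrow> nat \<Rightarrow> nat" where
  "entry \<pi> i = \<pi> ! (i - 1)"

type_synonym mesh = "nat list \<times> (nat \<times> nat) set"

definition mesh_pattern :: "mesh \<Rightarrow> bool" where
  "mesh_pattern q \<longleftrightarrow>
     (\<exists>k. fst q \<in> S k \<and> snd q \<subseteq> {0..k} \<times> {0..k})"

definition order_isomorphic :: "nat list \<Rightarrow> nat list \<Rightarrow> bool" where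
  "order_isomorphic xs ys \<longleftrightarrow> length xs = length ys \<and>
     (\<forall>a<length xs. \<forall>b<length xs. xs ! a < xs ! b \<longleftrightarrow> ys ! a < ys ! b)"

text \<open>
  An occurrence is identified with its set \<open>I\<close> of positions. Below, \<open>i ! a\<close> and \<open>v ! b\<close>
  are the grid lines \<open>i\<^sub>a\<close> and \<open>v\<^sub>b\<close>, including the boundary ones for indices \<open>0\<close> and \<open>k + 1\<close>.
\<close>

fun is_occurrence :: "mesh \<Rightarrow> nat list \<Rightarrow> nat set \<Rightarrow> bool" where
  "is_occurrence (\<tau>, R) \<pi> I \<longleftrightarrow>
     (let n = length \<pi>;
          positions = sorted_list_of_set I;
          subsequence = map (entry \<pi>) positions;
          i = [0] @ positions @ [n + 1];
          v = [0] @ sort subsequence @ [n + 1]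
      in I \<subseteq> {1..n} \<and> order_isomorphic subsequence \<tau> \<and>
         (\<forall>(a, b)\<in>R. \<not> (\<exists>m\<in>{1..n}.
            i ! a < m \<and> m < i ! (a + 1) \<and> v ! b < entry \<pi> m \<and> entry \<pi> m < v ! (b + 1))))"

definition num_occurrences :: "mesh \<Rightarrow> nat list \<Rightarrow> nat" where
  "num_occurrences q \<pi> = card {I. is_occurrence q \<pi> I}"

definition joint_count :: "mesh \<Rightarrow> mesh \<Rightarrow> nat \<Rightarrow> nat \<Rightarrow> nat \<Rightarrow> nat" where
  "joint_count q1 q2 n k l =
     card {\<pi> \<in> S n. num_occurrences q1 \<pi> = k \<and> num_occurrences q2 \<pi> = l}"

definition jointly_equidistributed :: "mesh \<Rightarrow> mesh \<Rightarrow> bool" (infix "\<sim>\<^sub>j\<^sub>d" 50) where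
  "q1 \<sim>\<^sub>j\<^sub>d q2 \<longleftrightarrow> (\<forall>n k l. joint_count q1 q2 n k l = joint_count q1 q2 n l k)"

definition same_joint_distribution :: "mesh \<times> mesh \<Rightarrow> mesh \<times> mesh \<Rightarrow> bool" where
  "same_joint_distribution p p' \<longleftrightarrow>
     (\<forall>n k l. joint_count (fst p) (snd p) n k l = joint_count (fst p') (snd p') n k l)"

text \<open>The eight shadings; only the values at \<open>j = 1, \<dots>, 8\<close> are meaningful.\<close>

definition shading :: "nat \<Rightarrow> (nat \<times> nat) set" where
  "shading j =
    [{(0,0),(0,1),(0,2),(0,3),(1,1),(1,3),(2,1),(2,2),(2,3),(3,3)},
     {(0,0),(0,1),(0,2),(0,3),(1,1),(2,1),(2,2),(2,3),(3,1),(3,3)},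
     {(0,0),(0,1),(0,2),(0,3),(1,1),(1,2),(1,3),(2,2),(3,2),(3,3)},
     {(0,0),(0,1),(0,2),(0,3),(1,1),(1,2),(2,2),(3,1),(3,2),(3,3)},
     {(0,0),(1,0),(2,0),(3,0),(1,1),(1,2),(2,2),(3,1),(3,2),(3,3)},
     {(0,0),(1,0),(2,0),(3,0),(1,1),(1,2),(1,3),(2,2),(3,2),(3,3)},
     {(0,0),(1,0),(2,0),(3,0),(1,1),(2,1),(2,2),(2,3),(3,1),(3,3)},
     {(0,0),(1,0),(2,0),(3,0),(1,1),(1,3),(2,1),(2,2),(2,3),(3,3)}] ! (j - 1)"

lemma mesh_pattern_shading:
  assumes "j \<in> {1..8}"
  shows "mesh_pattern ([1,2,3], shading j)" and "mesh_pattern ([1,3,2], shading j)"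
proof -
  have j: "j \<in> {1,2,3,4,5,6,7,8}"
    using assms by auto
  have sub: "shading j \<subseteq> {0..3} \<times> {0..3}"
    using j by (auto simp: shading_def)
  have "{1..3::nat} = {1,2,3}" by auto
  then have "[1,2,3] \<in> S 3" "[1,3,2] \<in> S 3"
    by (auto simp: S_def permutations_of_set_def)
  with sub show "mesh_pattern ([1,2,3], shading j)" "mesh_pattern ([1,3,2], shading j)"
    unfolding mesh_pattern_def by auto
qed

end

theory Submission
  imports Defs "HOL-Library.Infinite_Set"
begin

text \<open>
  A completely shaded column 0 forces the first entry of an occurrence to be \<open>\<pi>\<^sub>1\<close>; being the least
  value of the occurrence, it leaves a mesh pattern 12 or 21 to be found among the entries
  exceeding \<open>\<pi>\<^sub>1\<close>, which form an arbitrary permutation \<open>\<sigma>\<close>. For the shadings 1 to 4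
  the remaining mesh patterns are obtained from one another by reverse-complement and inverse of
  \<open>\<sigma>\<close>, both of which preserve 12 and 21; shadings 5 to 8 are the transposes of 1 to 4, and inverting
  \<open>\<pi>\<close> preserves 123 and 132. Hence all eight pairs have the same joint distribution.

  For its symmetry, exchanging the two values of an occurrence of 12 in \<open>\<sigma>\<close> produces an occurrence of 21
  with the same shading, and vice versa, so both patterns have the same total number of occurrences.
  For shading 1 every permutation contains at most one occurrence of either pattern,
  and two \<open>0\<close>-\<open>1\<close>-valued statistics with the same sum are jointly symmetric.
\<close>

section \<open>Mesh patterns in point sets\<close>

text \<open>
  \<open>A\<close> and \<open>B\<close> are the sets of vertical and horizontal grid lines of a candidate occurrence. A point off
  the grid lies in the box indexed by the numbers of lines to its left and below it, so the boundary
  lines \<open>0\<close> and \<open>n + 1\<close> play no role.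
\<close>

definition clear :: "(nat \<times> nat) set \<Rightarrow> nat set \<Rightarrow> nat set \<Rightarrow> (nat \<times> nat) set \<Rightarrow> bool" where
  "clear R A B P \<longleftrightarrow>
     (\<forall>(x, y)\<in>P. x \<notin> A \<longrightarrow> y \<notin> B \<longrightarrow> (card {a\<in>A. a < x}, card {b\<in>B. b < y}) \<notin> R)"

definition occurs ::
  "((nat \<times> nat) set \<Rightarrow> bool) \<Rightarrow> (nat \<times> nat) set \<Rightarrow> (nat \<times> nat) set \<Rightarrow> (nat \<times> nat) set \<Rightarrow> bool" where
  "occurs T R P C \<longleftrightarrow> C \<subseteq> P \<and> T C \<and> clear R (fst ` C) (snd ` C) P"

definition occ_count ::
  "((nat \<times> nat) set \<Rightarrow> bool) \<Rightarrow> (nat \<times> nat) set \<Rightarrow> (nat \<times> nat) set \<Rightarrow> nat" where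
  "occ_count T R P = card {C. occurs T R P C}"

text \<open>Since the equivalence is required for \<open>u\<close>, \<open>v\<close> in both orders,
  a tie in one coordinate is a tie in the other; with \<open>card C = 2\<close> the two points lie
  in different rows and different columns. The same holds for \<open>falling2\<close>.\<close>

definition rising2 :: "(nat \<times> nat) set \<Rightarrow> bool" where
  "rising2 C \<longleftrightarrow> card C = 2 \<and> (\<forall>u\<in>C. \<forall>v\<in>C. fst u < fst v \<longleftrightarrow> snd u < snd v)"

definition falling2 :: "(nat \<times> nat) set \<Rightarrow> bool" where
  "falling2 C \<longleftrightarrow> card C = 2 \<and> (\<forall>u\<in>C. \<forall>v\<in>C. fst u < fst v \<longleftrightarrow> snd v < snd u)"

text \<open>The patterns 123 and 132 are the cones over 12 and 21.\<close>

definition cone :: "((nat \<times> nat) set \<Rightarrow> bool) \<Rightarrow> (nat \<times> nat) set \<Rightarrow> bool" where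
  "cone T C \<longleftrightarrow> (\<exists>p D. C = insert p D \<and> T D \<and> (\<forall>z\<in>D. fst p < fst z \<and> snd p < snd z))"

definition general_position :: "(nat \<times> nat) set \<Rightarrow> bool" where
  "general_position P \<longleftrightarrow> finite P \<and> inj_on fst P \<and> inj_on snd P"

definition perm_graphs :: "nat \<Rightarrow> (nat \<times> nat) set set" where
  "perm_graphs n = {P. bij_betw fst P {1..n} \<and> bij_betw snd P {1..n}}"

lemma two_setE:
  assumes "card C = 2"
  obtains u v where "C = {u, v}" "u \<noteq> v"
  using assms by (meson card_2_iff)

lemma rising2_iff:
  "rising2 C \<longleftrightarrow> (\<exists>a b c d. a < b \<and> c < d \<and> C = {(a, c), (b, d)})"
proof
  assume L: "rising2 C"
  then obtain u v where uv: "C = {u, v}" "u \<noteq> v"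
    unfolding rising2_def by (meson two_setE)
  have "fst u < fst v \<and> snd u < snd v \<or> fst v < fst u \<and> snd v < snd u"
    using L uv unfolding rising2_def by (auto simp: prod_eq_iff)
  moreover have "C = {(fst u, snd u), (fst v, snd v)}" "C = {(fst v, snd v), (fst u, snd u)}"
    using uv by auto
  ultimately show "\<exists>a b c d. a < b \<and> c < d \<and> C = {(a, c), (b, d)}"
    by blast
qed (auto simp: rising2_def card_2_iff)

lemma falling2_iff:
  "falling2 C \<longleftrightarrow> (\<exists>a b c d. a < b \<and> c < d \<and> C = {(a, d), (b, c)})"
proof
  assume L: "falling2 C"
  then obtain u v where uv: "C = {u, v}" "u \<noteq> v"
    unfolding falling2_def by (meson two_setE)
  have "fst u < fst v \<and> snd v < snd u \<or> fst v < fst u \<and> snd u < snd v"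
    using L uv unfolding falling2_def by (auto simp: prod_eq_iff)
  moreover have "C = {(fst u, snd u), (fst v, snd v)}" "C = {(fst v, snd v), (fst u, snd u)}"
    using uv by auto
  ultimately show "\<exists>a b c d. a < b \<and> c < d \<and> C = {(a, d), (b, c)}"
    by blast
qed (auto simp: falling2_def card_2_iff)

lemma perm_graphs_iff:
  "P \<in> perm_graphs n \<longleftrightarrow> general_position P \<and> fst ` P = {1..n} \<and> snd ` P = {1..n}"
proof -
  have "finite P" if "inj_on fst P" "fst ` P = {1..n}"
    using that finite_imageD[of fst P] by simp
  then show ?thesis
    unfolding perm_graphs_def general_position_def bij_betw_def by blast
qed

lemma perm_graphs_bounds:
  assumes "P \<in> perm_graphs n"
  shows "P \<subseteq> {1..n} \<times> {1..n}"
proof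
  fix z assume "z \<in> P"
  then have "fst z \<in> fst ` P" "snd z \<in> snd ` P" by (rule imageI)+
  moreover have "fst ` P = {1..n}" "snd ` P = {1..n}"
    using assms unfolding perm_graphs_iff by blast+
  ultimately show "z \<in> {1..n} \<times> {1..n}" by (simp add: mem_Times_iff)
qed

lemma general_position_eq:
  assumes "general_position Q" "(a, b) \<in> Q" "(c, d) \<in> Q"
  shows "a = c \<longleftrightarrow> b = d"
proof -
  have "inj_on fst Q" "inj_on snd Q"
    using assms(1) unfolding general_position_def by blast+
  from this[THEN inj_onD, of "(a, b)" "(c, d)"] show ?thesis
    using assms(2,3) by auto
qed

lemma perm_graphs_eq:
  assumes "P \<in> perm_graphs n" "(a, b) \<in> P" "(c, d) \<in> P"
  shows "a = c \<longleftrightarrow> b = d"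
  using general_position_eq[OF _ assms(2,3)] assms(1) unfolding perm_graphs_iff by blast

lemma finite_perm_graphs: "finite (perm_graphs n)"
  by (rule finite_subset[of _ "Pow ({1..n} \<times> {1..n})"])
    (use perm_graphs_bounds in blast, simp)

lemma general_position_subset: "general_position P \<Longrightarrow> Q \<subseteq> P \<Longrightarrow> general_position Q"
  unfolding general_position_def by (meson finite_subset inj_on_subset)

lemma finite_occurrences: "finite P \<Longrightarrow> finite {C. occurs T R P C}"
  by (rule finite_subset[of _ "Pow P"]) (auto simp: occurs_def)

section \<open>Occurrence counts under maps of the point set\<close>

lemma occ_count_image:
  assumes "inj_on \<psi> P"
    and "\<And>C. C \<subseteq> P \<Longrightarrow> occurs T R' (\<psi> ` P) (\<psi> ` C) \<longleftrightarrow> occurs T R P C"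
  shows "occ_count T R' (\<psi> ` P) = occ_count T R P"
proof -
  \<comment> \<open>Every subset of the image of \<open>P\<close> is the image of a subset of
    \<open>P\<close>, which is unique because \<open>\<psi>\<close> is injective on
    \<open>P\<close>.\<close>
  have "{C. occurs T R' (\<psi> ` P) C} = image \<psi> ` {C. occurs T R P C}"
  proof safe
    fix C assume "occurs T R' (\<psi> ` P) C"
    moreover from this obtain D where "D \<subseteq> P" "C = \<psi> ` D"
      unfolding occurs_def by (meson subset_imageE)
    ultimately show "C \<in> image \<psi> ` {C. occurs T R P C}"
      using assms(2) by auto
  qed (use assms(2) occurs_def in auto)
  moreover have "inj_on (image \<psi>) {C. occurs T R P C}"
    by (rule inj_on_subset[OF inj_on_image_Pow[OF assms(1)]]) (auto simp: occurs_def)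
  ultimately show ?thesis
    by (simp add: occ_count_def card_image)
qed

lemma image_fst_swap: "fst ` prod.swap ` Q = snd ` Q"
  and image_snd_swap: "snd ` prod.swap ` Q = fst ` Q"
  by (simp_all add: image_image)

text \<open>Swapping exchanges vertical with horizontal grid lines, so the box index of each point
  is transposed along with the point.\<close>

lemma occ_count_swap:
  assumes "\<And>C. T (prod.swap ` C) \<longleftrightarrow> T C"
  shows "occ_count T (prod.swap ` R) (prod.swap ` P) = occ_count T R P"
proof (rule occ_count_image)
  have mem: "(a, b) \<in> prod.swap ` R \<longleftrightarrow> (b, a) \<in> R" for a b
    by force
  have "prod.swap ` C \<subseteq> prod.swap ` P \<longleftrightarrow> C \<subseteq> P" for C
    by (simp add: inj_image_subset_iff)
  moreover have "clear (prod.swap ` R) B A (prod.swap ` P) \<longleftrightarrow> clear R A B P" for A B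
    unfolding clear_def by (simp add: mem split_beta) blast
  ultimately show "occurs T (prod.swap ` R) (prod.swap ` P) (prod.swap ` C) \<longleftrightarrow> occurs T R P C" for C
    unfolding occurs_def by (simp only: assms image_fst_swap image_snd_swap)
qed simp

lemma swap_rising2: "rising2 (prod.swap ` C) \<longleftrightarrow> rising2 C"
  by (auto simp: rising2_def card_image)

lemma swap_falling2: "falling2 (prod.swap ` C) \<longleftrightarrow> falling2 C"
  unfolding falling2_def by (simp add: card_image) blast

lemma swap_cone:
  assumes "\<And>C. T (prod.swap ` C) \<longleftrightarrow> T C"
  shows "cone T (prod.swap ` C) \<longleftrightarrow> cone T C"
proof -
  have "cone T (prod.swap ` C)" if "cone T C" for C
  proof -
    from that obtain p D where pD: "C = insert p D" "T D" "\<forall>z\<in>D. fst p < fst z \<and> snd p < snd z"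
      unfolding cone_def by blast
    then have "prod.swap ` C = insert (prod.swap p) (prod.swap ` D)" "T (prod.swap ` D)"
      "\<forall>z\<in>prod.swap ` D. fst (prod.swap p) < fst z \<and> snd (prod.swap p) < snd z"
      using assms by auto
    then show ?thesis unfolding cone_def by blast
  qed
  \<comment> \<open>Swapping twice is the identity, so the implication for the swapped set is the
    converse.\<close>
  from this[of C] this[of "prod.swap ` C"] show ?thesis
    by (auto simp: image_image)
qed

text \<open>The counted number is the box index of \<open>x\<close> relative to the lines
  \<open>A\<close>; an increasing relabelling preserves it.\<close>

lemma card_below_mono:
  fixes f :: "nat \<Rightarrow> nat"
  assumes "strict_mono_on X f" "A \<subseteq> X" "x \<in> X"
  shows "card {a \<in> f ` A. a < f x} = card {a \<in> A. a < x}"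
proof -
  have "f a < f x \<longleftrightarrow> a < x" if "a \<in> A" for a
    using assms that by (metis strict_mono_on_less subsetD)
  then have "{a \<in> f ` A. a < f x} = f ` {a \<in> A. a < x}" by auto
  moreover have "inj_on f {a \<in> A. a < x}"
    by (rule inj_on_subset[OF strict_mono_on_imp_inj_on[OF assms(1)]]) (use assms(2) in auto)
  ultimately show ?thesis by (simp add: card_image)
qed

lemma strict_antimono_on_less:
  fixes f :: "'a :: linorder \<Rightarrow> 'b :: linorder"
  assumes "strict_antimono_on X f" "x \<in> X" "y \<in> X"
  shows "f x < f y \<longleftrightarrow> y < x"
proof
  show "y < x" if "f x < f y"
  proof (rule ccontr)
    assume "\<not> y < x"
    then have "x = y \<or> x < y" by auto
    with that assms show False
      using monotone_onD[OF assms(1), of x y] by auto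
  qed
qed (use monotone_onD[OF assms(1)] assms in auto)

lemma strict_antimono_on_imp_inj_on:
  fixes f :: "'a :: linorder \<Rightarrow> 'b :: linorder"
  assumes "strict_antimono_on X f"
  shows "inj_on f X"
proof (rule inj_onI)
  fix x y assume "x \<in> X" "y \<in> X" "f x = f y"
  then show "x = y"
    using strict_antimono_on_less[OF assms, of x y] strict_antimono_on_less[OF assms, of y x]
    by auto
qed

text \<open>The lines below \<open>f x\<close> are the images of those above \<open>x\<close>; as
  \<open>x\<close> is itself no line, these are all of \<open>A\<close> except the lines below
  \<open>x\<close>.\<close>

lemma card_below_antimono:
  fixes f :: "nat \<Rightarrow> nat"
  assumes "strict_antimono_on X f" "A \<subseteq> X" "x \<in> X" "finite A" "x \<notin> A"
  shows "card {a \<in> f ` A. a < f x} = card A - card {a \<in> A. a < x}"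
proof -
  have "f a < f x \<longleftrightarrow> x < a" if "a \<in> A" for a
    using strict_antimono_on_less[OF assms(1)] assms(2,3) that by auto
  then have "{a \<in> f ` A. a < f x} = f ` {a \<in> A. x < a}" by auto
  moreover have "inj_on f {a \<in> A. x < a}"
    by (rule inj_on_subset[OF strict_antimono_on_imp_inj_on[OF assms(1)]]) (use assms(2) in auto)
  moreover have "{a \<in> A. x < a} = A - {a \<in> A. a < x}"
    using assms(5) by (auto simp: not_less le_less)
  ultimately show ?thesis 
    using assms(4) by (simp add: card_image card_Diff_subset)
qed

lemma image_fst_map_prod: "fst ` map_prod f g ` C = f ` fst ` C"
  by force

lemma image_snd_map_prod: "snd ` map_prod f g ` C = g ` snd ` C"
  by force

lemma pattern_map_mono:
  fixes f g :: "nat \<Rightarrow> nat"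
  assumes fg: "strict_mono_on X f" "strict_mono_on Y g" and C: "C \<subseteq> X \<times> Y"
  shows "rising2 (map_prod f g ` C) \<longleftrightarrow> rising2 C" "falling2 (map_prod f g ` C) \<longleftrightarrow> falling2 C"
proof -
  have "inj_on (map_prod f g) C"
    by (rule inj_on_subset[OF map_prod_inj_on C]) (use fg in \<open>auto intro: strict_mono_on_imp_inj_on\<close>)
  then have c: "card (map_prod f g ` C) = card C" by (rule card_image)
  have 1: "f (fst u) < f (fst v) \<longleftrightarrow> fst u < fst v" "g (snd u) < g (snd v) \<longleftrightarrow> snd u < snd v" 
    if "u \<in> C" "v \<in> C" for u v
    using strict_mono_on_less[OF fg(1)] strict_mono_on_less[OF fg(2)] subsetD[OF C] that
    by (simp_all add: mem_Times_iff)
  show "rising2 (map_prod f g ` C) \<longleftrightarrow> rising2 C" "falling2 (map_prod f g ` C) \<longleftrightarrow> falling2 C"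
    unfolding rising2_def falling2_def c by (simp_all add: 1)
qed

text \<open>Both comparisons are reversed at once, and the condition ranges over all ordered pairs,
  so interchanging \<open>u\<close> and \<open>v\<close> restores it.\<close>

lemma pattern_map_antimono:
  fixes f g :: "nat \<Rightarrow> nat"
  assumes fg: "strict_antimono_on X f" "strict_antimono_on Y g" and C: "C \<subseteq> X \<times> Y"
  shows "rising2 (map_prod f g ` C) \<longleftrightarrow> rising2 C" "falling2 (map_prod f g ` C) \<longleftrightarrow> falling2 C"
proof -
  have "inj_on (map_prod f g) C"
    by (rule inj_on_subset[OF map_prod_inj_on C]) (use fg in \<open>auto intro: strict_antimono_on_imp_inj_on\<close>)
  then have c: "card (map_prod f g ` C) = card C" by (rule card_image)
  have 1: "f (fst u) < f (fst v) \<longleftrightarrow> fst v < fst u" "g (snd u) < g (snd v) \<longleftrightarrow> snd v < snd u" 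
    if "u \<in> C" "v \<in> C" for u v
    using strict_antimono_on_less[OF fg(1)] strict_antimono_on_less[OF fg(2)] subsetD[OF C] that
    by (simp_all add: mem_Times_iff)
  have 2: "rising2 (map_prod f g ` C) \<longleftrightarrow> card C = 2 \<and> (\<forall>u\<in>C. \<forall>v\<in>C. fst v < fst u \<longleftrightarrow> snd v < snd u)"
    "falling2 (map_prod f g ` C) \<longleftrightarrow> card C = 2 \<and> (\<forall>u\<in>C. \<forall>v\<in>C. fst v < fst u \<longleftrightarrow> snd u < snd v)"
    unfolding rising2_def falling2_def c by (simp_all add: 1)
  show "rising2 (map_prod f g ` C) \<longleftrightarrow> rising2 C" "falling2 (map_prod f g ` C) \<longleftrightarrow> falling2 C"
    unfolding 2 unfolding rising2_def falling2_def by blast+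
qed

definition size2_pattern :: "((nat \<times> nat) set \<Rightarrow> bool) \<Rightarrow> bool" where
  "size2_pattern T \<longleftrightarrow> T = rising2 \<or> T = falling2"

lemma size2_pattern_simps [simp]: "size2_pattern rising2" "size2_pattern falling2"
  by (auto simp: size2_pattern_def)

lemma size2_pattern_card: "size2_pattern T \<Longrightarrow> T C \<Longrightarrow> card C = 2"
  by (auto simp: size2_pattern_def rising2_def falling2_def)

lemma occ_count_map_mono:
  assumes T: "size2_pattern T" and fg: "strict_mono_on X f" "strict_mono_on Y g" and P: "P \<subseteq> X \<times> Y"
  shows "occ_count T R (map_prod f g ` P) = occ_count T R P"
proof (rule occ_count_image)
  have inj: "inj_on (map_prod f g) (X \<times> Y)" and inj': "inj_on f X" "inj_on g Y"
    using fg by (auto intro!: map_prod_inj_on strict_mono_on_imp_inj_on)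
  then show "inj_on (map_prod f g) P"
    using P inj_on_subset by blast
  fix C assume C: "C \<subseteq> P"
  have "T (map_prod f g ` C) \<longleftrightarrow> T C"
    using T C P pattern_map_mono[OF fg, of C] by (auto simp: size2_pattern_def)
  moreover have "map_prod f g ` C \<subseteq> map_prod f g ` P"
    using C by blast
  moreover have "clear R (f ` fst ` C) (g ` snd ` C) (map_prod f g ` P) \<longleftrightarrow> clear R (fst ` C) (snd ` C) P"
  proof -
    define A B where "A = fst ` C" and "B = snd ` C"
    have AB: "A \<subseteq> X" "B \<subseteq> Y" using C P by (auto simp: A_def B_def)
    have "f x \<in> f ` A \<longleftrightarrow> x \<in> A" "g y \<in> g ` B \<longleftrightarrow> y \<in> B"
      "card {a \<in> f ` A. a < f x} = card {a \<in> A. a < x}"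
      "card {b \<in> g ` B. b < g y} = card {b \<in> B. b < y}" if "(x, y) \<in> P" for x y
      using subsetD[OF P that] card_below_mono[OF fg(1) AB(1)] card_below_mono[OF fg(2) AB(2)]
        inj_on_image_mem_iff[OF inj'(1) _ AB(1)] inj_on_image_mem_iff[OF inj'(2) _ AB(2)]
      by simp_all
    then show ?thesis
      unfolding clear_def A_def[symmetric] B_def[symmetric] by (fastforce simp: split_beta)
  qed
  ultimately show "occurs T R (map_prod f g ` P) (map_prod f g ` C) \<longleftrightarrow> occurs T R P C"
    using C unfolding occurs_def by (simp add: image_fst_map_prod image_snd_map_prod)
qed

text \<open>The half turn of the 3 by 3 array of boxes belonging to a pattern of length two: the
  effect of reverse-complement on a shading.\<close>

definition rotate2 :: "(nat \<times> nat) set \<Rightarrow> (nat \<times> nat) set" where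
  "rotate2 R = (\<lambda>(a, b). (2 - a, 2 - b)) ` R"

text \<open>Truncated subtraction from 2 is injective on \<open>{0..2}\<close> only, so the box
  indices and the shading are kept in that range.\<close>

lemma rotate2_iff:
  assumes "R \<subseteq> {0..2} \<times> {0..2}" "a \<le> 2" "b \<le> 2"
  shows "(2 - a, 2 - b) \<in> rotate2 R \<longleftrightarrow> (a, b) \<in> R"
proof
  assume "(2 - a, 2 - b) \<in> rotate2 R"
  then obtain c d where cd: "(c, d) \<in> R" "2 - a = 2 - c" "2 - b = 2 - d"
    by (auto simp: rotate2_def)
  with assms(1) have "c \<le> 2" "d \<le> 2" by auto
  with cd assms show "(a, b) \<in> R"
    by (metis diff_diff_cancel)
qed (auto simp: rotate2_def)

lemma occ_count_map_antimono:
  assumes T: "size2_pattern T" and fg: "strict_antimono_on X f" "strict_antimono_on Y g"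
    and P: "P \<subseteq> X \<times> Y" "general_position P" and R: "R \<subseteq> {0..2} \<times> {0..2}"
  shows "occ_count T (rotate2 R) (map_prod f g ` P) = occ_count T R P"
proof (rule occ_count_image)
  have inj: "inj_on (map_prod f g) (X \<times> Y)" and inj': "inj_on f X" "inj_on g Y"
    using fg by (auto intro!: map_prod_inj_on strict_antimono_on_imp_inj_on)
  then show "inj_on (map_prod f g) P"
    using P inj_on_subset by blast
  fix C assume C: "C \<subseteq> P"
  have "T (map_prod f g ` C) \<longleftrightarrow> T C"
    using T C P pattern_map_antimono[OF fg, of C] by (auto simp: size2_pattern_def)
  moreover have "map_prod f g ` C \<subseteq> map_prod f g ` P"
    using C by blast
  \<comment> \<open>Under \<open>T C\<close> there are exactly two lines in each direction, so
    reversal turns a box index \<open>a\<close> into \<open>2 - a\<close>.\<close>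
  moreover have "clear (rotate2 R) (f ` fst ` C) (g ` snd ` C) (map_prod f g ` P) \<longleftrightarrow>
      clear R (fst ` C) (snd ` C) P" if "T C"
  proof -
    define A B where "A = fst ` C" and "B = snd ` C"
    have AB: "A \<subseteq> X" "B \<subseteq> Y" using C P by (auto simp: A_def B_def)
    have "card C = 2" using size2_pattern_card[OF T that] .
    moreover have "inj_on fst C" "inj_on snd C" "finite C"
      using P(2) C unfolding general_position_def by (auto intro: inj_on_subset finite_subset)
    ultimately have fin: "finite A" "finite B" "card A = 2" "card B = 2"
      by (auto simp: A_def B_def card_image)
    have "f x \<in> f ` A \<longleftrightarrow> x \<in> A" "g y \<in> g ` B \<longleftrightarrow> y \<in> B" if "(x, y) \<in> P" for x y
      using subsetD[OF P(1) that] inj_on_image_mem_iff[OF inj'(1) _ AB(1)]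
        inj_on_image_mem_iff[OF inj'(2) _ AB(2)]
      by simp_all
    moreover have
      "(card {a \<in> f ` A. a < f x}, card {b \<in> g ` B. b < g y}) \<in> rotate2 R \<longleftrightarrow>
       (card {a \<in> A. a < x}, card {b \<in> B. b < y}) \<in> R" if "(x, y) \<in> P" "x \<notin> A" "y \<notin> B" for x y
    proof -
      have "card {a \<in> f ` A. a < f x} = 2 - card {a \<in> A. a < x}"
        "card {b \<in> g ` B. b < g y} = 2 - card {b \<in> B. b < y}"
        using card_below_antimono[OF fg(1) AB(1)] card_below_antimono[OF fg(2) AB(2)] fin that P by auto
      moreover have "card {a \<in> A. a < x} \<le> 2" "card {b \<in> B. b < y} \<le> 2"
        using card_mono[OF fin(1), of "{a \<in> A. a < x}"] card_mono[OF fin(2), of "{b \<in> B. b < y}"] fin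
        by auto
      ultimately show ?thesis
        by (simp only: rotate2_iff[OF R])
    qed
    ultimately show ?thesis
      unfolding clear_def A_def[symmetric] B_def[symmetric] by (fastforce simp: split_beta)
  qed
  ultimately show "occurs T (rotate2 R) (map_prod f g ` P) (map_prod f g ` C) \<longleftrightarrow> occurs T R P C"
    using C unfolding occurs_def by (auto simp add: image_fst_map_prod image_snd_map_prod)
qed

section \<open>Reduction to patterns of length two\<close>

text \<open>
  The eight shadings force (possibly after inversion) the smallest entry of an occurrence to be
  \<open>\<pi>\<^sub>1\<close>, and what remains is a condition on the points above \<open>\<pi>\<^sub>1\<close> alone.
\<close>

definition upper :: "(nat \<times> nat) set \<Rightarrow> (nat \<times> nat) set" where
  "upper P = {z \<in> P. \<forall>y. (1, y) \<in> P \<longrightarrow> y < snd z}"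

text \<open>Adding an apex below and to the left of an occurrence of length two adds one line on the
  left and one below, hence the shift of \<open>R\<close>.\<close>

definition lift :: "(nat \<times> nat) set \<Rightarrow> (nat \<times> nat) set" where
  "lift R = {0} \<times> {0..3} \<union> map_prod Suc Suc ` R"

lemma lift_iff [simp]:
  "(0, b) \<in> lift R \<longleftrightarrow> b \<le> 3" "(Suc a, Suc b) \<in> lift R \<longleftrightarrow> (a, b) \<in> R" "(Suc a, 0) \<notin> lift R"
  by (auto simp: lift_def)

lemma size2_pattern_not_empty:
  assumes "size2_pattern T"
  shows "\<not> T {}" "\<not> cone T {}"
  using size2_pattern_card[OF assms, of "{}"] by (auto simp: cone_def)

text \<open>The lines \<open>1\<close> and \<open>m\<close> raise both box indices of a point above
  row \<open>m\<close> by one. A point below row \<open>m\<close> lies in row 0 to the right of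
  column 0, where \<open>lift R\<close> shades nothing.\<close>

lemma clear_lift:
  assumes "1 \<notin> A" "finite A" "finite B" "\<And>b. b \<in> B \<Longrightarrow> m < b"
    and P: "P \<in> perm_graphs n" "(1, m) \<in> P"
  shows "clear (lift R) (insert 1 A) (insert m B) P \<longleftrightarrow> clear R A B (upper P)"
proof -
  have up: "(x, y) \<in> upper P \<longleftrightarrow> (x, y) \<in> P \<and> m < y" for x y
    using perm_graphs_eq[OF P] P(2) by (auto simp: upper_def)
  have "(x \<notin> insert 1 A \<and> y \<notin> insert m B \<and>
         (card {a \<in> insert 1 A. a < x}, card {b \<in> insert m B. b < y}) \<in> lift R) \<longleftrightarrow>
        (x \<notin> A \<and> y \<notin> B \<and> m < y \<and> (card {a \<in> A. a < x}, card {b \<in> B. b < y}) \<in> R)"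
    if xy: "(x, y) \<in> P" for x y
  proof -
    have x1: "x = 1 \<longleftrightarrow> y = m" "1 \<le> x"
      using perm_graphs_eq[OF P(1) xy P(2)] perm_graphs_bounds[OF P(1)] xy by auto
    show ?thesis
    proof (cases "m < y")
      case True
      then have "1 < x" using x1 by auto
      then have "{a \<in> insert 1 A. a < x} = insert 1 {a \<in> A. a < x}" by auto
      moreover have "{b \<in> insert m B. b < y} = insert m {b \<in> B. b < y}" using True by auto
      ultimately show ?thesis
        using True \<open>1 < x\<close> assms by (auto simp: card_insert_if)
    next
      case False
      have "(card {a \<in> insert 1 A. a < x}, card {b \<in> insert m B. b < y}) \<notin> lift R" if "x \<noteq> 1"
      proof -
        have "1 < x" using x1 that by auto
        then have "{a \<in> insert 1 A. a < x} = insert 1 {a \<in> A. a < x}" by auto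
        then have 1: "card {a \<in> insert 1 A. a < x} = Suc (card {a \<in> A. a < x})"
          using assms by simp
        have "{b \<in> insert m B. b < y} = {}" using False assms(4) by force
        then have 2: "card {b \<in> insert m B. b < y} = 0" by (simp only: card.empty)
        show ?thesis unfolding 1 2 by simp
      qed
      then show ?thesis using False by auto
    qed
  qed
  then show ?thesis
    unfolding clear_def using up by (fastforce simp: split_beta)
qed

text \<open>Removing the apex is a bijection between the two kinds of occurrences: the shaded column
  0 forces the apex to be the point in column 1, and \<open>clear_lift\<close> compares the
  remaining shadings.\<close>

lemma occ_count_cone:
  assumes P: "P \<in> perm_graphs n" and T: "size2_pattern T"
  shows "occ_count (cone T) (lift R) P = occ_count T R (upper P)"
proof (cases "P = {}")
  case True
  \<comment> \<open>Without points there is no first entry to serve as apex; both counts vanish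
    because neither pattern is empty.\<close>
  have "\<not> occurs (cone T) (lift R) P C" "\<not> occurs T R (upper P) C" for C
    using True size2_pattern_not_empty[OF T] by (cases "C = {}"; simp add: occurs_def upper_def)+
  then show ?thesis
    by (simp add: occ_count_def)
next
  case False
  have gp: "inj_on fst P" "inj_on snd P" "finite P" "fst ` P = {1..n}" "snd ` P = {1..n}"
    using P unfolding perm_graphs_iff general_position_def by blast+
  have "n \<ge> 1"
    using False gp(4) by (metis atLeastatMost_empty_iff image_is_empty)
  then have "1 \<in> fst ` P" unfolding gp by simp
  then obtain m where m: "(1, m) \<in> P" by auto
  have up: "(x, y) \<in> upper P \<longleftrightarrow> (x, y) \<in> P \<and> m < y" for x y
    using perm_graphs_eq[OF P] m by (auto simp: upper_def)
  have gt: "1 < x" if "(x, y) \<in> upper P" for x y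
    using that up perm_graphs_eq[OF P, of x y 1 m] m perm_graphs_bounds[OF P] by force
  have clear_iff: "clear (lift R) (fst ` insert (1, m) D) (snd ` insert (1, m) D) P \<longleftrightarrow>
      clear R (fst ` D) (snd ` D) (upper P)" if "D \<subseteq> upper P" for D
  proof -
    have "finite D"
      using that gp(3) by (auto simp: upper_def intro: finite_subset)
    then show ?thesis
      using clear_lift[OF _ _ _ _ P m, of "fst ` D" "snd ` D" R] that gt up by fastforce
  qed
  have "{C. occurs (cone T) (lift R) P C} = insert (1, m) ` {D. occurs T R (upper P) D}"
  proof (intro set_eqI iffI)
    fix C assume "C \<in> insert (1, m) ` {D. occurs T R (upper P) D}"
    then obtain D where D: "C = insert (1, m) D" "D \<subseteq> upper P" "T D"
        "clear R (fst ` D) (snd ` D) (upper P)"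
      by (auto simp: occurs_def)
    moreover have "cone T C"
      unfolding cone_def using D gt up by (intro exI[of _ "(1, m)"] exI[of _ D]) fastforce
    moreover have "C \<subseteq> P" using D m by (auto simp: upper_def)
    ultimately show "C \<in> {C. occurs (cone T) (lift R) P C}"
      using clear_iff by (simp add: occurs_def)
  next
    fix C assume "C \<in> {C. occurs (cone T) (lift R) P C}"
    then have C: "C \<subseteq> P" "cone T C" and cl: "clear (lift R) (fst ` C) (snd ` C) P"
      by (auto simp: occurs_def)
    then obtain p D where D: "C = insert p D" "T D" and low: "\<forall>z\<in>D. fst p < fst z \<and> snd p < snd z"
      by (auto simp: cone_def)
    have "card C = 3"
    proof -
      have "card D = 2" using size2_pattern_card[OF T D(2)] .
      moreover from this have "finite D" by (metis card.infinite zero_neq_numeral)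
      moreover have "p \<notin> D" using low by auto
      ultimately show ?thesis using D(1) by simp
    qed
    \<comment> \<open>Otherwise the point \<open>(1, m)\<close> is to the left of all vertical lines
      and on no horizontal line. It then lies in a box of column 0 with row index at most 3, and
      that box is shaded.\<close>
    have "p = (1, m)"
    proof (rule ccontr)
      assume "p \<noteq> (1, m)"
      have "p \<in> P" using C D by auto
      then have "1 < fst p"
        using \<open>p \<noteq> (1, m)\<close> perm_graphs_eq[OF P m, of "fst p" "snd p"] perm_graphs_bounds[OF P] 
        by (cases p) force
      then have lt: "\<forall>a\<in>fst ` C. 1 < a" using D low by auto
      then have "1 \<notin> fst ` C" by blast
      have "m \<notin> snd ` C"
      proof
        assume "m \<in> snd ` C"
        then obtain a where "(a, m) \<in> C" by auto
        then show False using C perm_graphs_eq[OF P, of a m 1 m] m lt by force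
      qed
      have "{a \<in> fst ` C. a < 1} = {}" using lt by auto
      then have "card {a \<in> fst ` C. a < 1} = 0" by (simp only: card.empty)
      moreover have "card {b \<in> snd ` C. b < m} \<le> 3"
        using \<open>card C = 3\<close> card_image_le[of C snd] card_mono[of "snd ` C" "{b \<in> snd ` C. b < m}"]
        by (metis (no_types, lifting) card.infinite finite_imageI mem_Collect_eq order_trans subsetI zero_neq_numeral)
      moreover have "(card {a \<in> fst ` C. a < 1}, card {b \<in> snd ` C. b < m}) \<notin> lift R"
        using cl m \<open>1 \<notin> fst ` C\<close> \<open>m \<notin> snd ` C\<close> unfolding clear_def by blast
      ultimately show False by (simp only: lift_iff simp_thms)
    qed
    have "D \<subseteq> upper P"
    proof
      fix z assume "z \<in> D"
      then have "z \<in> P" "m < snd z" using D low C \<open>p = (1, m)\<close> by auto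
      then show "z \<in> upper P" using up[of "fst z" "snd z"] by simp
    qed
    then have "clear R (fst ` D) (snd ` D) (upper P)"
      using clear_iff[OF \<open>D \<subseteq> upper P\<close>] cl D(1) \<open>p = (1, m)\<close> by simp
    then show "C \<in> insert (1, m) ` {D. occurs T R (upper P) D}"
      using \<open>D \<subseteq> upper P\<close> D \<open>p = (1, m)\<close> by (auto simp: occurs_def)
  qed
  moreover have "inj_on (insert (1, m)) {D. occurs T R (upper P) D}"
  proof (rule inj_onI)
    fix D E assume "D \<in> {D. occurs T R (upper P) D}" "E \<in> {D. occurs T R (upper P) D}"
    then have "(1, m) \<notin> D" "(1, m) \<notin> E" by (auto simp: occurs_def up)
    then show "insert (1, m) D = insert (1, m) E \<Longrightarrow> D = E" by (metis insert_ident)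
  qed
  ultimately show ?thesis
    by (simp add: occ_count_def card_image)
qed

lemma general_position_upper: "P \<in> perm_graphs n \<Longrightarrow> general_position (upper P)"
  using general_position_subset[of P "upper P"] by (auto simp: perm_graphs_iff upper_def)

text \<open>
  \<open>G\<close> keeps the rows and columns occupied by the upper points, so rearranging them by \<open>G\<close> permutes the
  permutation graphs.
\<close>

lemma card_rearrange_upper:
  assumes fst_G: "\<And>Q. general_position Q \<Longrightarrow> bij_betw fst (G Q) (fst ` Q)"
    and snd_G: "\<And>Q. general_position Q \<Longrightarrow> bij_betw snd (G Q) (snd ` Q)"
    and inj: "inj_on G (Collect general_position)"
  shows "card {P \<in> perm_graphs n. F (G (upper P))} = card {P \<in> perm_graphs n. F (upper P)}"
proof -
  define \<Phi> where "\<Phi> P = (P - upper P) \<union> G (upper P)" for P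
  have \<Phi>: "\<Phi> P \<in> perm_graphs n \<and> upper (\<Phi> P) = G (upper P)" if P: "P \<in> perm_graphs n" for P
  proof
    have gp: "general_position (upper P)" using general_position_upper[OF P] .
    have P': "bij_betw fst P {1..n}" "bij_betw snd P {1..n}" "upper P \<subseteq> P"
      using P by (auto simp: perm_graphs_def upper_def)
    have "bij_betw h (\<Phi> P) {1..n}" if h: "bij_betw h P {1..n}" and "bij_betw h (G (upper P)) (h ` upper P)"
      for h
    proof -
      have "bij_betw h (P - upper P) ({1..n} - h ` upper P)"
        using h P'(3) by (smt (verit) Diff_subset bij_betw_def inj_on_image_set_diff inj_on_subset)
      then have "bij_betw h (\<Phi> P) (({1..n} - h ` upper P) \<union> h ` upper P)"
        unfolding \<Phi>_def by (rule bij_betw_combine) (use that in auto)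
      moreover have "h ` upper P \<subseteq> {1..n}" using h P'(3) by (auto simp: bij_betw_def)
      ultimately show ?thesis by (simp add: Un_absorb2)
    qed
    then show "\<Phi> P \<in> perm_graphs n"
      using P' fst_G[OF gp] snd_G[OF gp] by (simp add: perm_graphs_def)
    have fG: "fst ` G (upper P) = fst ` upper P" and sG: "snd ` G (upper P) = snd ` upper P"
      using fst_G[OF gp] snd_G[OF gp] by (auto simp: bij_betw_def)
    \<comment> \<open>The point in column 1 is not above itself, so it is not rearranged and the
      threshold defining the upper points is unchanged.\<close>
    have no1: "1 \<notin> fst ` upper P"
      using perm_graphs_eq[OF P] by (force simp: upper_def)
    have one: "(1, y) \<in> \<Phi> P \<longleftrightarrow> (1, y) \<in> P" for y
      using no1 fG unfolding \<Phi>_def by (force simp: image_iff)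
    have up: "(x, y) \<in> upper (\<Phi> P) \<longleftrightarrow> (x, y) \<in> \<Phi> P \<and> (\<forall>z. (1, z) \<in> P \<longrightarrow> z < y)" for x y
      unfolding upper_def[of "\<Phi> P"] using one by simp
    have "(x, y) \<in> upper (\<Phi> P) \<longleftrightarrow> (x, y) \<in> G (upper P)" for x y
    proof
      assume xy: "(x, y) \<in> G (upper P)"
      then have "y \<in> snd ` upper P" using sG by force
      then have "\<forall>z. (1, z) \<in> P \<longrightarrow> z < y" by (auto simp: upper_def)
      with xy show "(x, y) \<in> upper (\<Phi> P)" unfolding up by (simp add: \<Phi>_def)
    next
      assume "(x, y) \<in> upper (\<Phi> P)"
      then have "(x, y) \<in> \<Phi> P" "\<forall>z. (1, z) \<in> P \<longrightarrow> z < y" unfolding up by blast+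
      then show "(x, y) \<in> G (upper P)" by (auto simp: \<Phi>_def upper_def)
    qed
    then show "upper (\<Phi> P) = G (upper P)" by auto
  qed
  have inj\<Phi>: "inj_on \<Phi> (perm_graphs n)"
  proof (rule inj_onI)
    fix P P' assume P: "P \<in> perm_graphs n" "P' \<in> perm_graphs n" and eq: "\<Phi> P = \<Phi> P'"
    then have "G (upper P) = G (upper P')" using \<Phi> by metis
    then have u: "upper P = upper P'"
      using inj P general_position_upper by (auto simp: inj_on_def)
    \<comment> \<open>The remaining points can be read off \<open>\<Phi> P\<close>: rearranged
      points occupy only rows of upper points, so none of them coincides with a point that is not
      upper.\<close>
    have "P - upper P = \<Phi> P - upper (\<Phi> P)" if "P \<in> perm_graphs n" for P
    proof -
      have "z \<notin> G (upper P)" if "z \<in> P" "z \<notin> upper P" for z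
      proof
        assume "z \<in> G (upper P)"
        then have "snd z \<in> snd ` upper P"
          using snd_G[OF general_position_upper[OF \<open>P \<in> perm_graphs n\<close>]] by (auto simp: bij_betw_def)
        then show False using that by (auto simp: upper_def)
      qed
      then show ?thesis using \<Phi>[OF that] by (auto simp: \<Phi>_def)
    qed
    then have "P - upper P = P' - upper P'" using P eq by metis
    with u show "P = P'" by (auto simp: upper_def)
  qed
  have im: "\<Phi> ` perm_graphs n = perm_graphs n"
    by (rule endo_inj_surj[OF finite_perm_graphs _ inj\<Phi>]) (use \<Phi> in auto)
  have "{P \<in> perm_graphs n. F (upper P)} = \<Phi> ` {P \<in> perm_graphs n. F (G (upper P))}"
  proof safe
    fix P assume "P \<in> perm_graphs n" "F (upper P)"
    moreover from this im obtain P' where "P' \<in> perm_graphs n" "P = \<Phi> P'" by blast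
    ultimately show "P \<in> \<Phi> ` {P \<in> perm_graphs n. F (G (upper P))}"
      using \<Phi> by auto
  qed (use \<Phi> in auto)
  moreover have "inj_on \<Phi> {P \<in> perm_graphs n. F (G (upper P))}"
    by (rule inj_on_subset[OF inj\<Phi>]) auto
  ultimately show ?thesis by (simp add: card_image)
qed

section \<open>Reverse-complement and inverse of the upper points\<close>

text \<open>For finite \<open>X\<close> and \<open>Y\<close> of equal size this is the
  order-preserving bijection, unique on \<open>X\<close>. Since the choice depends on the sets
  alone, point sets with the same rows and columns get the same relabelling; the injectivity of the
  rearrangements rests on this.\<close>

definition increasing_map :: "nat set \<Rightarrow> nat set \<Rightarrow> nat \<Rightarrow> nat" where
  "increasing_map X Y = (SOME f. bij_betw f X Y \<and> strict_mono_on X f)"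

definition decreasing_map :: "nat set \<Rightarrow> nat \<Rightarrow> nat" where
  "decreasing_map X = (SOME f. bij_betw f X X \<and> strict_antimono_on X f)"

lemma ex_rank:
  fixes X :: "nat set"
  assumes "finite X"
  obtains r where "bij_betw r X {..<card X}" "strict_mono_on X r"
proof -
  obtain h where h: "bij_betw h {..<card X} X" "strict_mono_on {..<card X} h"
    using ex_bij_betw_strict_mono_card[OF assms] by blast
  define r where "r = inv_into {..<card X} h"
  have bij: "bij_betw r X {..<card X}"
    unfolding r_def by (rule bij_betw_inv_into[OF h(1)])
  have "strict_mono_on X r"
  proof (rule strict_mono_onI)
    fix x y assume xy: "x \<in> X" "y \<in> X" "x < y"
    then have "h (r x) = x" "h (r y) = y"
      unfolding r_def by (simp_all add: bij_betw_inv_into_right[OF h(1)])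
    moreover have "r x \<in> {..<card X}" "r y \<in> {..<card X}"
      using xy bij_betw_apply[OF bij] by blast+
    ultimately show "r x < r y"
      using strict_mono_on_less[OF h(2)] xy(3) by metis
  qed
  with bij show thesis by (rule that)
qed

lemma increasing_map:
  assumes "finite X" "finite Y" "card X = card Y"
  shows "bij_betw (increasing_map X Y) X Y" "strict_mono_on X (increasing_map X Y)"
proof -
  obtain r where r: "bij_betw r X {..<card X}" "strict_mono_on X r"
    using ex_rank[OF assms(1)] .
  obtain h where h: "bij_betw h {..<card Y} Y" "strict_mono_on {..<card Y} h"
    using ex_bij_betw_strict_mono_card[OF assms(2)] by blast
  \<comment> \<open>The element of rank \<open>i\<close> in \<open>X\<close> goes to the element of
    rank \<open>i\<close> in \<open>Y\<close>.\<close>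
  have "bij_betw (h \<circ> r) X Y"
    using r(1) h(1) assms(3) by (auto intro: bij_betw_trans)
  moreover have "strict_mono_on X (h \<circ> r)"
  proof (rule strict_mono_onI)
    fix x y assume xy: "x \<in> X" "y \<in> X" "x < y"
    then have "r x < r y" "r x \<in> {..<card Y}" "r y \<in> {..<card Y}"
      using strict_mono_onD[OF r(2)] bij_betw_apply[OF r(1)] unfolding assms(3) by blast+
    then show "(h \<circ> r) x < (h \<circ> r) y"
      using strict_mono_onD[OF h(2)] by simp
  qed
  ultimately have "\<exists>f. bij_betw f X Y \<and> strict_mono_on X f" by blast
  from someI_ex[OF this] show "bij_betw (increasing_map X Y) X Y" "strict_mono_on X (increasing_map X Y)"
    unfolding increasing_map_def by blast+
qed

lemma decreasing_map:
  assumes "finite X"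
  shows "bij_betw (decreasing_map X) X X" "strict_antimono_on X (decreasing_map X)"
proof -
  obtain r where r: "bij_betw r X {..<card X}" "strict_mono_on X r"
    using ex_rank[OF assms(1)] .
  obtain h where h: "bij_betw h {..<card X} X" "strict_mono_on {..<card X} h"
    using ex_bij_betw_strict_mono_card[OF assms(1)] by blast
  \<comment> \<open>The element of rank \<open>i\<close>, counted from 0, goes to the one of rank
    \<open>card X - 1 - i\<close>.\<close>
  define f where "f x = h (card X - Suc (r x))" for x
  have r_less: "r x < card X" if "x \<in> X" for x
    using bij_betw_apply[OF r(1) that] by simp
  have anti: "strict_antimono_on X f"
  proof (rule monotone_onI)
    fix x y assume xy: "x \<in> X" "y \<in> X" "x < y"
    then have "r x < r y" using r(2) by (auto simp: strict_mono_onD)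
    then have "card X - Suc (r y) < card X - Suc (r x)" "card X - Suc (r x) < card X"
      using r_less[of y] xy by auto
    then show "f x > f y"
      using strict_mono_onD[OF h(2), of "card X - Suc (r y)" "card X - Suc (r x)"] by (auto simp: f_def)
  qed
  have "f ` X \<subseteq> X"
  proof clarify
    fix x assume "x \<in> X"
    then have "card X - Suc (r x) \<in> {..<card X}" using r_less[of x] by auto
    then show "f x \<in> X" unfolding f_def by (rule bij_betw_apply[OF h(1)])
  qed
  then have "bij_betw f X X"
    using endo_inj_surj[OF assms _ strict_antimono_on_imp_inj_on[OF anti]]
      strict_antimono_on_imp_inj_on[OF anti] by (auto simp: bij_betw_def)
  with anti have "\<exists>f. bij_betw f X X \<and> strict_antimono_on X f" by blast
  from someI_ex[OF this] show "bij_betw (decreasing_map X) X X" "strict_antimono_on X (decreasing_map X)"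
    unfolding decreasing_map_def by blast+
qed

lemma bij_betw_fst_map_prod:
  assumes "inj_on fst Q" "bij_betw f (fst ` Q) X"
  shows "bij_betw fst (map_prod f g ` Q) X"
  unfolding bij_betw_def
proof
  show "inj_on fst (map_prod f g ` Q)"
  proof (rule inj_onI, clarsimp)
    fix a b c d assume 1: "(a, b) \<in> Q" "(c, d) \<in> Q" "f a = f c"
    then have "a \<in> fst ` Q" "c \<in> fst ` Q" by force+
    then have "a = c"
      using assms(2) 1(3) by (auto simp: bij_betw_def dest: inj_onD)
    then show "g b = g d"
      using 1 inj_onD[OF assms(1), of "(a, b)" "(c, d)"] by simp
  qed
  show "fst ` map_prod f g ` Q = X"
    using assms(2) by (simp add: image_fst_map_prod bij_betw_def)
qed

lemma bij_betw_snd_map_prod: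
  assumes "inj_on snd Q" "bij_betw g (snd ` Q) Y"
  shows "bij_betw snd (map_prod f g ` Q) Y"
  unfolding bij_betw_def
proof
  show "inj_on snd (map_prod f g ` Q)"
  proof (rule inj_onI, clarsimp)
    fix a b c d assume 1: "(a, b) \<in> Q" "(c, d) \<in> Q" "g b = g d"
    then have "b \<in> snd ` Q" "d \<in> snd ` Q" by force+
    then have "b = d"
      using assms(2) 1(3) by (auto simp: bij_betw_def dest: inj_onD)
    then show "f a = f c"
      using 1 inj_onD[OF assms(1), of "(a, b)" "(c, d)"] by simp
  qed
  show "snd ` map_prod f g ` Q = Y"
    using assms(2) by (simp add: image_snd_map_prod bij_betw_def)
qed

lemma subset_fst_snd: "Q \<subseteq> fst ` Q \<times> snd ` Q"
  by force

text \<open>Reverse-complement of the pattern formed by \<open>Q\<close>, drawn in the rows and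
  columns that \<open>Q\<close> already occupies.\<close>

definition reverse_complement :: "(nat \<times> nat) set \<Rightarrow> (nat \<times> nat) set" where
  "reverse_complement Q = map_prod (decreasing_map (fst ` Q)) (decreasing_map (snd ` Q)) ` Q"

text \<open>Swapping interchanges the sets of rows and columns; the increasing maps carry the
  inverse pattern back to the columns and rows of \<open>Q\<close>.\<close>

definition inverse_graph :: "(nat \<times> nat) set \<Rightarrow> (nat \<times> nat) set" where
  "inverse_graph Q =
     map_prod (increasing_map (snd ` Q) (fst ` Q)) (increasing_map (fst ` Q) (snd ` Q)) ` prod.swap ` Q"

lemma reverse_complement_bij:
  assumes "general_position Q"
  shows "bij_betw fst (reverse_complement Q) (fst ` Q)" "bij_betw snd (reverse_complement Q) (snd ` Q)"
  using assms unfolding reverse_complement_def general_position_def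
  by (auto intro!: bij_betw_fst_map_prod bij_betw_snd_map_prod decreasing_map)

text \<open>The image has the same rows and columns as \<open>Q\<close>, so equal images arise from
  the same relabelling, which is injective.\<close>

lemma inj_on_reverse_complement: "inj_on reverse_complement (Collect general_position)"
proof (rule inj_onI, clarify)
  fix Q Q' assume Q: "general_position Q" "general_position Q'"
    and eq: "reverse_complement Q = reverse_complement Q'"
  have fs: "fst ` Q = fst ` Q'" "snd ` Q = snd ` Q'"
    using reverse_complement_bij[OF Q(1)] reverse_complement_bij[OF Q(2)] eq
    by (auto simp: bij_betw_def)
  let ?h = "map_prod (decreasing_map (fst ` Q)) (decreasing_map (snd ` Q))"
  have "inj_on ?h (fst ` Q \<times> snd ` Q)"
    using Q by (auto intro!: map_prod_inj_on strict_antimono_on_imp_inj_on decreasing_map simp: general_position_def)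
  moreover have "?h ` Q = ?h ` Q'"
    using eq fs by (simp add: reverse_complement_def)
  ultimately show "Q = Q'"
    using inj_on_image_eq_iff subset_fst_snd fs by metis
qed

lemma card_fst_snd: "general_position Q \<Longrightarrow> card (fst ` Q) = card (snd ` Q)"
  by (simp add: general_position_def card_image)

lemma swap_general_position:
  assumes "general_position Q"
  shows "general_position (prod.swap ` Q)"
proof -
  have "inj_on fst (prod.swap ` Q)" "inj_on snd (prod.swap ` Q)"
    using assms by (auto simp: general_position_def inj_on_def)
  with assms show ?thesis by (simp add: general_position_def)
qed

lemma inverse_graph_bij:
  assumes Q: "general_position Q"
  shows "bij_betw fst (inverse_graph Q) (fst ` Q)" "bij_betw snd (inverse_graph Q) (snd ` Q)"
proof -
  have "inj_on fst (prod.swap ` Q)" "inj_on snd (prod.swap ` Q)" "finite (fst ` Q)" "finite (snd ` Q)"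
    using Q swap_general_position[OF Q] by (simp_all add: general_position_def)
  then show "bij_betw fst (inverse_graph Q) (fst ` Q)" "bij_betw snd (inverse_graph Q) (snd ` Q)"
    unfolding inverse_graph_def using card_fst_snd[OF Q]
    by (simp_all add: bij_betw_fst_map_prod bij_betw_snd_map_prod increasing_map image_fst_swap image_snd_swap)
qed

lemma inj_on_inverse_graph: "inj_on inverse_graph (Collect general_position)"
proof (rule inj_onI, clarify)
  fix Q Q' assume Q: "general_position Q" "general_position Q'"
    and eq: "inverse_graph Q = inverse_graph Q'"
  have fs: "fst ` Q = fst ` Q'" "snd ` Q = snd ` Q'"
    using inverse_graph_bij[OF Q(1)] inverse_graph_bij[OF Q(2)] eq
    by (auto simp: bij_betw_def)
  let ?h = "map_prod (increasing_map (snd ` Q) (fst ` Q)) (increasing_map (fst ` Q) (snd ` Q))"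
  have "inj_on ?h (snd ` Q \<times> fst ` Q)"
    using Q card_fst_snd[OF Q(1)]
    by (auto intro!: map_prod_inj_on strict_mono_on_imp_inj_on increasing_map simp: general_position_def)
  moreover have "?h ` prod.swap ` Q = ?h ` prod.swap ` Q'"
    using eq fs by (simp add: inverse_graph_def)
  moreover have "prod.swap ` Q \<subseteq> snd ` Q \<times> fst ` Q"
    by force
  moreover have "prod.swap ` Q' \<subseteq> snd ` Q \<times> fst ` Q"
    unfolding fs by force
  ultimately have "prod.swap ` Q = prod.swap ` Q'"
    using inj_on_image_eq_iff by metis
  then show "Q = Q'" by (simp add: inj_image_eq_iff)
qed

lemma occ_count_reverse_complement:
  assumes "size2_pattern T" "general_position Q" "R \<subseteq> {0..2} \<times> {0..2}"
  shows "occ_count T (rotate2 R) (reverse_complement Q) = occ_count T R Q"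
  unfolding reverse_complement_def
  by (rule occ_count_map_antimono[OF assms(1) _ _ subset_fst_snd assms(2,3)])
    (use assms(2) in \<open>auto intro!: decreasing_map simp: general_position_def\<close>)

lemma occ_count_inverse_graph:
  assumes "size2_pattern T" "general_position Q"
  shows "occ_count T (prod.swap ` R) (inverse_graph Q) = occ_count T R Q"
proof -
  have sub: "prod.swap ` Q \<subseteq> snd ` Q \<times> fst ` Q" by force
  have "occ_count T (prod.swap ` R) (inverse_graph Q) = occ_count T (prod.swap ` R) (prod.swap ` Q)"
    unfolding inverse_graph_def
    by (rule occ_count_map_mono[OF assms(1) _ _ sub])
      (use assms(2) card_fst_snd[OF assms(2)] in \<open>auto intro!: increasing_map simp: general_position_def\<close>)
  also have "\<dots> = occ_count T R Q"
    by (rule occ_count_swap) (use assms(1) swap_rising2 swap_falling2 in \<open>auto simp: size2_pattern_def\<close>)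
  finally show ?thesis .
qed

section \<open>Joint counts on point sets and their invariance\<close>

definition graph_count :: "(nat \<times> nat) set \<Rightarrow> nat \<Rightarrow> nat \<Rightarrow> nat \<Rightarrow> nat" where
  "graph_count R n k l =
     card {P \<in> perm_graphs n. occ_count (cone rising2) R P = k \<and> occ_count (cone falling2) R P = l}"

lemma graph_count_lift:
  "graph_count (lift R) n k l =
     card {P \<in> perm_graphs n. occ_count rising2 R (upper P) = k \<and> occ_count falling2 R (upper P) = l}"
  unfolding graph_count_def by (rule arg_cong[of _ _ card]) (auto simp: occ_count_cone)

lemma graph_count_rearrange:
  assumes "\<And>Q. general_position Q \<Longrightarrow> bij_betw fst (G Q) (fst ` Q)"
    and "\<And>Q. general_position Q \<Longrightarrow> bij_betw snd (G Q) (snd ` Q)"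
    and "inj_on G (Collect general_position)"
    and occ: "\<And>T Q. size2_pattern T \<Longrightarrow> general_position Q \<Longrightarrow> occ_count T R' (G Q) = occ_count T R Q"
  shows "graph_count (lift R') n k l = graph_count (lift R) n k l"
proof -
  have "graph_count (lift R') n k l =
    card {P \<in> perm_graphs n. occ_count rising2 R' (G (upper P)) = k \<and> occ_count falling2 R' (G (upper P)) = l}"
    unfolding graph_count_lift by (rule card_rearrange_upper[symmetric, OF assms(1-3)])
  also have "\<dots> = graph_count (lift R) n k l"
    unfolding graph_count_lift
    by (rule arg_cong[of _ _ card]) (auto simp: occ general_position_upper)
  finally show ?thesis .
qed

lemma graph_count_rotate2:
  "R \<subseteq> {0..2} \<times> {0..2} \<Longrightarrow> graph_count (lift (rotate2 R)) n k l = graph_count (lift R) n k l"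
  by (rule graph_count_rearrange[OF reverse_complement_bij inj_on_reverse_complement])
    (auto simp: occ_count_reverse_complement)

text \<open>Here only the points above the first entry are inverted.\<close>

lemma graph_count_transpose2:
  "graph_count (lift (prod.swap ` R)) n k l = graph_count (lift R) n k l"
  by (rule graph_count_rearrange[OF inverse_graph_bij inj_on_inverse_graph])
    (auto simp: occ_count_inverse_graph)

lemma swap_perm_graphs: "P \<in> perm_graphs n \<Longrightarrow> prod.swap ` P \<in> perm_graphs n"
  using swap_general_position[of P] by (simp add: perm_graphs_iff image_image)

text \<open>Here the whole permutation is inverted; the cones over 12 and 21 are preserved by
  swapping coordinates.\<close>

lemma graph_count_transpose:
  "graph_count (prod.swap ` R) n k l = graph_count R n k l"
proof -
  have occ: "occ_count (cone T) (prod.swap ` R) (prod.swap ` P) = occ_count (cone T) R P"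
    if "T = rising2 \<or> T = falling2" for T P
    by (rule occ_count_swap, rule swap_cone) (use that swap_rising2 swap_falling2 in auto)
  have "{P \<in> perm_graphs n. occ_count (cone rising2) (prod.swap ` R) P = k \<and>
            occ_count (cone falling2) (prod.swap ` R) P = l} =
        image prod.swap ` {P \<in> perm_graphs n. occ_count (cone rising2) R P = k \<and> occ_count (cone falling2) R P = l}"
  proof safe
    fix P assume P: "P \<in> perm_graphs n"
    have "P = prod.swap ` prod.swap ` P" by (simp add: image_image)
    then show "P \<in> image prod.swap ` {Q \<in> perm_graphs n. 
        occ_count (cone rising2) R Q = occ_count (cone rising2) (prod.swap ` R) P \<and>
        occ_count (cone falling2) R Q = occ_count (cone falling2) (prod.swap ` R) P}"
      using swap_perm_graphs[OF P] occ[of rising2 "prod.swap ` P"] occ[of falling2 "prod.swap ` P"]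
      by (intro image_eqI[of _ _ "prod.swap ` P"]) auto
  qed (use swap_perm_graphs occ in auto)
  moreover have "inj_on (image prod.swap) M" for M :: "(nat \<times> nat) set set"
    by (rule inj_onI) (simp add: inj_image_eq_iff)
  ultimately show ?thesis
    unfolding graph_count_def by (simp add: card_image)
qed

section \<open>Symmetry\<close>

lemma image_involution_iff:
  assumes "\<And>z. f (f z) = z"
  shows "z \<in> f ` P \<longleftrightarrow> f z \<in> P"
  by (metis assms image_iff)

text \<open>
  Exchanging the two values of an occurrence moves points along the grid lines only, so the shaded
  boxes stay empty.
\<close>

lemma exchange_values:
  fixes c d :: nat
  defines "\<psi> \<equiv> map_prod id (transpose c d) :: nat \<times> nat \<Rightarrow> nat \<times> nat"
  assumes P: "P \<in> perm_graphs n" and D: "D \<subseteq> upper P" "snd ` D = {c, d}"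
  shows "\<psi> ` P \<in> perm_graphs n" "upper (\<psi> ` P) = \<psi> ` upper P"
    "clear R (fst ` D) {c, d} (\<psi> ` upper P) \<longleftrightarrow> clear R (fst ` D) {c, d} (upper P)"
    "fst ` \<psi> ` D = fst ` D" "snd ` \<psi> ` D = {c, d}" "\<psi> ` \<psi> ` Q = Q"
proof -
  have inv: "\<psi> (\<psi> z) = z" for z by (cases z) (simp add: \<psi>_def)
  show "\<psi> ` \<psi> ` Q = Q" by (simp add: image_image inv)
  show 1: "fst ` \<psi> ` D = fst ` D" "snd ` \<psi> ` D = {c, d}"
    unfolding \<psi>_def image_fst_map_prod image_snd_map_prod D(2) by auto
  have up: "{c, d} \<subseteq> snd ` upper P"
    unfolding D(2)[symmetric] by (rule image_mono[OF D(1)])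
  \<comment> \<open>Both exchanged values exceed the first entry, so the exchange fixes the point in
    column 1 and moves no point across its row.\<close>
  have cd: "y < c" "y < d" if "(1, y) \<in> P" for y
    using up that by (auto simp: upper_def)
  have cd': "c \<in> {1..n}" "d \<in> {1..n}"
    using up perm_graphs_bounds[OF P] by (auto simp: upper_def)
  have gp: "inj_on fst P" "inj_on snd P" "fst ` P = {1..n}" "snd ` P = {1..n}"
    using P unfolding perm_graphs_iff general_position_def by blast+
  show "\<psi> ` P \<in> perm_graphs n"
    unfolding perm_graphs_def \<psi>_def using gp cd'
    by (auto intro!: bij_betw_fst_map_prod bij_betw_snd_map_prod)
  have one: "(1, y) \<in> \<psi> ` P \<longleftrightarrow> (1, y) \<in> P" for y
  proof -
    have "(1, y) \<in> \<psi> ` P \<longleftrightarrow> (1, transpose c d y) \<in> P"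
      using image_involution_iff[OF inv, of "(1, y)" P] by (simp add: \<psi>_def)
    moreover have "transpose c d y = y" if "(1, transpose c d y) \<in> P \<or> (1, y) \<in> P"
      using cd[of y] cd[of "transpose c d y"] that 
      by (cases "y = c"; cases "y = d") auto
    ultimately show ?thesis by metis
  qed
  have "z \<in> upper (\<psi> ` P) \<longleftrightarrow> z \<in> \<psi> ` upper P" for z
  proof -
    have "y < snd (\<psi> z) \<longleftrightarrow> y < snd z" if "(1, y) \<in> P" for y
      using cd[OF that] by (cases z) (auto simp: \<psi>_def transpose_def)
    then show ?thesis
      unfolding image_involution_iff[OF inv] using one
      by (auto simp: upper_def image_involution_iff[OF inv])
  qed
  then show "upper (\<psi> ` P) = \<psi> ` upper P" by blast
  \<comment> \<open>A row off both lines is fixed by the transposition; a row on a line is carried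
    to a line, and both implications then hold vacuously.\<close>
  have "(x \<notin> A \<longrightarrow> transpose c d y \<notin> {c, d} \<longrightarrow> (k, card {b \<in> {c, d}. b < transpose c d y}) \<notin> R) \<longleftrightarrow>
      (x \<notin> A \<longrightarrow> y \<notin> {c, d} \<longrightarrow> (k, card {b \<in> {c, d}. b < y}) \<notin> R)" for A y and x k :: nat
  proof (cases "y \<in> {c, d}")
    case True
    then have "transpose c d y \<in> {c, d}" by auto
    with True show ?thesis by blast
  qed simp
  then show "clear R (fst ` D) {c, d} (\<psi> ` upper P) \<longleftrightarrow> clear R (fst ` D) {c, d} (upper P)"
    unfolding clear_def \<psi>_def split_beta ball_simps fst_map_prod snd_map_prod id_apply
    by (simp only:)
qed

text \<open>The map depends only on the row set of \<open>D\<close>, which the exchange preserves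
  when \<open>D\<close> is an occurrence; hence an occurrence and its image define the same
  map.\<close>

definition exchange :: "(nat \<times> nat) set \<Rightarrow> nat \<times> nat \<Rightarrow> nat \<times> nat" where
  "exchange D = map_prod id (transpose (Min (snd ` D)) (Max (snd ` D)))"

lemma rising2_pair: "a < b \<Longrightarrow> c < d \<Longrightarrow> rising2 {(a, c), (b, d)}"
  by (auto simp: rising2_def card_2_iff)

lemma falling2_pair: "a < b \<Longrightarrow> c < d \<Longrightarrow> falling2 {(a, d), (b, c)}"
  by (auto simp: falling2_def card_2_iff)

lemma exchange_cong: "snd ` C = snd ` D \<Longrightarrow> exchange C = exchange D"
  by (simp add: exchange_def)

text \<open>The exchange turns \<open>{(a, c), (b, d)}\<close> into \<open>{(a, d), (b, c)}\<close>
  and back. Both sets determine the same grid lines, so the shaded boxes stay empty.\<close>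

lemma occurs_exchange:
  assumes P: "P \<in> perm_graphs n" and occ: "occurs T R (upper P) D" and T: "size2_pattern T" "size2_pattern T'" "T \<noteq> T'"
  shows "exchange D ` P \<in> perm_graphs n" "occurs T' R (upper (exchange D ` P)) (exchange D ` D)"
    "exchange (exchange D ` D) = exchange D" "exchange D ` exchange D ` Q = Q"
proof -
  have D: "D \<subseteq> upper P" "T D" "clear R (fst ` D) (snd ` D) (upper P)"
    using occ by (auto simp: occurs_def)
  have "\<exists>a b c d. a < b \<and> c < d \<and> (D = {(a, c), (b, d)} \<and> T' = falling2 \<or> D = {(a, d), (b, c)} \<and> T' = rising2)"
    using T D(2) unfolding size2_pattern_def by (metis rising2_iff falling2_iff)
  then obtain a b c d where abcd: "a < b" "c < d"
    and alt: "D = {(a, c), (b, d)} \<and> T' = falling2 \<or> D = {(a, d), (b, c)} \<and> T' = rising2"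
    by blast
  have sD: "snd ` D = {c, d}" using alt by auto
  have ex: "exchange D = map_prod id (transpose c d)"
    using abcd by (simp add: exchange_def sD)
  note * = exchange_values[OF P D(1) sD, folded ex]
  show "exchange D ` P \<in> perm_graphs n" "exchange D ` exchange D ` Q = Q" by (fact *)+
  have "snd ` exchange D ` D = snd ` D" using * sD by simp
  then show "exchange (exchange D ` D) = exchange D"
    by (rule exchange_cong)
  have "T' (exchange D ` D)"
    using alt
  proof
    assume "D = {(a, c), (b, d)} \<and> T' = falling2"
    then have "exchange D ` D = {(a, d), (b, c)}" "T' = falling2"
      unfolding ex by auto
    then show ?thesis using falling2_pair[OF abcd] by simp
  next
    assume "D = {(a, d), (b, c)} \<and> T' = rising2"
    then have "exchange D ` D = {(a, c), (b, d)}" "T' = rising2"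
      unfolding ex by auto
    then show ?thesis using rising2_pair[OF abcd] by simp
  qed
  then show "occurs T' R (upper (exchange D ` P)) (exchange D ` D)"
    using * D sD by (auto simp: occurs_def)
qed

lemma finite_upper: "P \<in> perm_graphs n \<Longrightarrow> finite (upper P)"
  using general_position_upper by (auto simp: general_position_def)

text \<open>Both sums count pairs of a permutation and an occurrence in its upper points. Exchanging
  the two values, in the permutation as well as in the occurrence, is an involution between the
  rising and the falling pairs.\<close>

lemma sum_occ_count_eq:
  "(\<Sum>P\<in>perm_graphs n. occ_count rising2 R (upper P)) = (\<Sum>P\<in>perm_graphs n. occ_count falling2 R (upper P))"
proof -
  define M where "M T = Sigma (perm_graphs n) (\<lambda>P. {D. occurs T R (upper P) D})" for T
  have card_M: "card (M T) = (\<Sum>P\<in>perm_graphs n. occ_count T R (upper P))" for T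
    unfolding M_def occ_count_def
    by (rule card_SigmaI) (auto intro: finite_perm_graphs finite_occurrences finite_upper)
  define E where "E = (\<lambda>(P, D). (exchange D ` P, exchange D ` D))"
  have E: "E z \<in> M T' \<and> E (E z) = z"
    if z: "z \<in> M T" and T: "size2_pattern T" "size2_pattern T'" "T \<noteq> T'" for T T' z
  proof -
    obtain P D where PD: "z = (P, D)" "P \<in> perm_graphs n" "occurs T R (upper P) D"
      using z by (auto simp: M_def)
    note * = occurs_exchange[OF PD(2,3) T]
    have "E z = (exchange D ` P, exchange D ` D)" by (simp only: E_def PD(1) prod.case)
    moreover have "E (exchange D ` P, exchange D ` D) = (P, D)"
      by (simp only: E_def prod.case *)
    ultimately show ?thesis using * by (simp add: M_def PD(1))
  qed
  have ne: "rising2 \<noteq> falling2"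
  proof
    assume "rising2 = falling2"
    then have "rising2 {(0, 0), (1, 1)} = falling2 {(0, 0), (1, 1)}" by simp
    then show False by (simp add: rising2_def falling2_def)
  qed
  note E' = E[OF _ size2_pattern_simps ne] E[OF _ size2_pattern_simps(2,1) ne[symmetric]]
  have "bij_betw E (M rising2) (M falling2)"
    by (rule bij_betw_byWitness[where f' = E]) (use E' in blast)+
  then show ?thesis
    using bij_betw_same_card card_M by metis
qed

text \<open>Shading 1 with column 0 dropped and the other indices lowered by one.\<close>

definition base_shading :: "(nat \<times> nat) set" where
  "base_shading = {(0,0), (0,2), (1,0), (1,1), (1,2), (2,2)}"

text \<open>
  The full top row makes the larger value of an occurrence the maximum of all points, and the full
  middle column makes the other point its neighbour.
\<close>

lemma clear_base_shading:
  assumes "clear base_shading {a, b} {c, d} Q" "a < b" "c < d" "(x, y) \<in> Q" "x \<notin> {a, b}" "y \<notin> {c, d}"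
  shows "y < d" "\<not> (a < x \<and> x < b)"
proof -
  have *: "(card {t \<in> {a, b}. t < x}, card {t \<in> {c, d}. t < y}) \<notin> base_shading"
    using assms unfolding clear_def by blast
  have le: "card {t \<in> {p, q}. t < z} \<le> 2" for p q z :: nat
  proof -
    have "card {t \<in> {p, q}. t < z} \<le> card {p, q}" by (rule card_mono) auto
    also have "\<dots> \<le> 2" by (cases "p = q") auto
    finally show ?thesis .
  qed
  have two: "k = 0 \<or> k = 1 \<or> k = 2" if "k \<le> 2" for k :: nat
    using that by auto
  show "y < d"
  proof (rule ccontr)
    assume "\<not> y < d"
    \<comment> \<open>The point lies above both horizontal lines, in row 2, whose three boxes are
      all shaded.\<close>
    then have "{t \<in> {c, d}. t < y} = {c, d}" using assms by auto
    then have "card {t \<in> {c, d}. t < y} = 2" using assms(3) by simp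
    then show False using * two[OF le[of a b x]] by (auto simp: base_shading_def)
  qed
  show "\<not> (a < x \<and> x < b)"
  proof
    assume "a < x \<and> x < b"
    \<comment> \<open>Exactly one vertical line lies to the left, so the point is in column 1, whose
      three boxes are all shaded.\<close>
    then have "{t \<in> {a, b}. t < x} = {a}" by auto
    then have "card {t \<in> {a, b}. t < x} = 1" by simp
    then show False using * two[OF le[of c d y]] by (auto simp: base_shading_def)
  qed
qed

text \<open>The point with the larger value is the maximum of \<open>Q\<close>, hence common to both
  occurrences. If the other points differed, one of them would lie strictly between the columns of
  the other occurrence.\<close>

lemma base_shading_unique:
  assumes Q: "general_position Q" and T: "size2_pattern T"
    and C: "occurs T base_shading Q C" and D: "occurs T base_shading Q D"
  shows "C = D"
proof -
  note eq = general_position_eq[OF Q]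
  show ?thesis
  proof (cases "T = rising2")
    case True
    obtain a b c d where 1: "a < b" "c < d" "C = {(a, c), (b, d)}"
      using C True by (auto simp: occurs_def rising2_iff)
    obtain a' b' c' d' where 2: "a' < b'" "c' < d'" "D = {(a', c'), (b', d')}"
      using D True by (auto simp: occurs_def rising2_iff)
    have cl: "clear base_shading {a, b} {c, d} Q" "clear base_shading {a', b'} {c', d'} Q"
      and mem: "(a, c) \<in> Q" "(b, d) \<in> Q" "(a', c') \<in> Q" "(b', d') \<in> Q"
      using C D 1(3) 2(3) by (auto simp: occurs_def)
    \<comment> \<open>By general position a point on a grid line belongs to the occurrence; any
      other point is below the top line.\<close>
    have "y \<le> d \<and> y \<le> d'" if "(x, y) \<in> Q" for x y
      using clear_base_shading(1)[OF cl(1) 1(1,2) that] clear_base_shading(1)[OF cl(2) 2(1,2) that]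
        eq[OF that mem(1)] eq[OF that mem(2)] eq[OF that mem(3)] eq[OF that mem(4)] 1(2) 2(2)
      by auto
    then have "d = d'" using mem by (meson order_antisym)
    then have "b = b'" using eq[OF mem(2,4)] by simp
    have "a = a'"
      using clear_base_shading(2)[OF cl(1) 1(1,2) mem(3)] clear_base_shading(2)[OF cl(2) 2(1,2) mem(1)]
        \<open>b = b'\<close> \<open>d = d'\<close> 1(1,2) 2(1,2) eq[OF mem(1,3)] by auto
    then show ?thesis
      using 1 2 \<open>b = b'\<close> \<open>d = d'\<close> eq[OF mem(1,3)] by simp
  next
    case False
    then have T: "T = falling2" using T by (simp add: size2_pattern_def)
    obtain a b c d where 1: "a < b" "c < d" "C = {(a, d), (b, c)}"
      using C T by (auto simp: occurs_def falling2_iff)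
    obtain a' b' c' d' where 2: "a' < b'" "c' < d'" "D = {(a', d'), (b', c')}"
      using D T by (auto simp: occurs_def falling2_iff)
    have cl: "clear base_shading {a, b} {c, d} Q" "clear base_shading {a', b'} {c', d'} Q"
      and mem: "(a, d) \<in> Q" "(b, c) \<in> Q" "(a', d') \<in> Q" "(b', c') \<in> Q"
      using C D 1(3) 2(3) by (auto simp: occurs_def insert_commute)
    have "y \<le> d \<and> y \<le> d'" if "(x, y) \<in> Q" for x y
      using clear_base_shading(1)[OF cl(1) 1(1,2) that] clear_base_shading(1)[OF cl(2) 2(1,2) that]
        eq[OF that mem(1)] eq[OF that mem(2)] eq[OF that mem(3)] eq[OF that mem(4)] 1(2) 2(2)
      by auto
    then have "d = d'" using mem by (meson order_antisym)
    then have "a = a'" using eq[OF mem(1,3)] by simp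
    have "b = b'"
      using clear_base_shading(2)[OF cl(1) 1(1,2) mem(4)] clear_base_shading(2)[OF cl(2) 2(1,2) mem(2)]
        \<open>a = a'\<close> \<open>d = d'\<close> 1(1,2) 2(1,2) eq[OF mem(2,4)] by auto
    then show ?thesis
      using 1 2 \<open>a = a'\<close> \<open>d = d'\<close> eq[OF mem(2,4)] by simp
  qed
qed

lemma occ_count_base_shading_le:
  assumes "general_position Q" "size2_pattern T"
  shows "occ_count T base_shading Q \<le> 1"
  unfolding occ_count_def using assms base_shading_unique[OF assms]
  by (simp add: card_le_Suc0_iff_eq finite_occurrences general_position_def)

text \<open>Equal sums make \<open>f x = 1\<close> and \<open>g x = 1\<close> equally frequent;
  removing the common case where both are 1 leaves equally many elements with values
  \<open>(1, 0)\<close> and \<open>(0, 1)\<close>.\<close>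

lemma card_joint_symmetric:
  fixes f g :: "'a \<Rightarrow> nat"
  assumes M: "finite M" and f: "\<And>x. x \<in> M \<Longrightarrow> f x \<le> 1" and g: "\<And>x. x \<in> M \<Longrightarrow> g x \<le> 1"
    and eq: "sum f M = sum g M"
  shows "card {x \<in> M. f x = k \<and> g x = l} = card {x \<in> M. f x = l \<and> g x = k}"
proof -
  have sum: "sum h M = card {x \<in> M. h x = 1}" if "\<And>x. x \<in> M \<Longrightarrow> h x \<le> 1" for h :: "'a \<Rightarrow> nat"
  proof -
    have "sum h M = (\<Sum>x\<in>M. if h x = 1 then 1 else 0)"
      by (rule sum.cong) (use that in \<open>force simp: le_Suc_eq\<close>)+
    then show ?thesis using M by (simp add: sum.If_cases Int_def)
  qed
  have split: "card {x \<in> M. h x = 1} = card {x \<in> M. h x = 1 \<and> h' x = 0} + card {x \<in> M. h x = 1 \<and> h' x = 1}"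
    if "\<And>x. x \<in> M \<Longrightarrow> h' x \<le> 1" for h h' :: "'a \<Rightarrow> nat"
  proof -
    have "{x \<in> M. h x = 1} = {x \<in> M. h x = 1 \<and> h' x = 0} \<union> {x \<in> M. h x = 1 \<and> h' x = 1}"
      using that by (force simp: le_Suc_eq)
    then show ?thesis using M by (simp only:) (subst card_Un_disjoint, auto)
  qed
  have "{x \<in> M. f x = 1 \<and> g x = 1} = {x \<in> M. g x = 1 \<and> f x = 1}" by auto
  then have 1: "card {x \<in> M. f x = 1 \<and> g x = 0} = card {x \<in> M. g x = 1 \<and> f x = 0}"
    using split[of g f, OF g] split[of f g, OF f] sum[OF f] sum[OF g] eq by simp
  have 2: "card {x \<in> M. f x = 1 \<and> g x = 0} = card {x \<in> M. f x = 0 \<and> g x = 1}"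
    unfolding 1 by (rule arg_cong[of _ _ card]) auto
  have empty: "{x \<in> M. f x = p \<and> g x = q} = {}" if "p > 1 \<or> q > 1" for p q
    using f g that by fastforce
  consider "k = l" | "k > 1 \<or> l > 1" | "k = 0 \<and> l = 1" | "k = 1 \<and> l = 0" by linarith
  then show ?thesis
  proof cases
    case 2
    have "{x \<in> M. f x = k \<and> g x = l} = {}" "{x \<in> M. f x = l \<and> g x = k} = {}"
      by (rule empty, use 2 in blast)+
    then show ?thesis by (simp only:)
  qed (use 2 in auto)
qed

lemma graph_count_base_symmetric:
  "graph_count (lift base_shading) n k l = graph_count (lift base_shading) n l k"
  unfolding graph_count_lift
  by (rule card_joint_symmetric[OF finite_perm_graphs _ _ sum_occ_count_eq])
    (auto simp only: intro!: occ_count_base_shading_le general_position_upper size2_pattern_simps)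

section \<open>Permutations as point sets\<close>

definition graph :: "nat list \<Rightarrow> (nat \<times> nat) set" where
  "graph \<pi> = (\<lambda>i. (i, entry \<pi> i)) ` {1..length \<pi>}"

lemma S_iff: "\<pi> \<in> S n \<longleftrightarrow> set \<pi> = {1..n} \<and> distinct \<pi>"
  by (simp add: S_def permutations_of_set_def)

lemma length_S: "\<pi> \<in> S n \<Longrightarrow> length \<pi> = n"
  using distinct_card[of \<pi>] by (simp add: S_iff)

lemma bij_betw_entry:
  assumes "\<pi> \<in> S n"
  shows "bij_betw (entry \<pi>) {1..n} {1..n}"
proof -
  have "bij_betw (\<lambda>i. i - 1) {1..n} {..<n}"
    by (rule bij_betw_byWitness[where f' = Suc]) auto
  moreover have "bij_betw ((!) \<pi>) {..<n} {1..n}"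
    using assms length_S[OF assms] by (intro bij_betw_nth) (auto simp: S_iff)
  ultimately have "bij_betw ((!) \<pi> \<circ> (\<lambda>i. i - 1)) {1..n} {1..n}"
    by (rule bij_betw_trans)
  then show ?thesis by (simp add: entry_def[abs_def] comp_def)
qed

lemma graph_in_perm_graphs:
  assumes "\<pi> \<in> S n"
  shows "graph \<pi> \<in> perm_graphs n"
proof -
  let ?g = "\<lambda>i. (i, entry \<pi> i)"
  have graph: "graph \<pi> = ?g ` {1..n}"
    by (simp add: graph_def length_S[OF assms])
  have comp: "fst \<circ> ?g = id" "snd \<circ> ?g = entry \<pi>"
    by (simp_all add: comp_def id_def)
  have "inj_on (snd \<circ> ?g) {1..n}" "(snd \<circ> ?g) ` {1..n} = {1..n}"
    unfolding comp using bij_betw_entry[OF assms] by (simp_all add: bij_betw_def)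
  moreover have "inj_on (fst \<circ> ?g) {1..n}" "(fst \<circ> ?g) ` {1..n} = {1..n}"
    unfolding comp by simp_all
  ultimately show ?thesis
    unfolding perm_graphs_def bij_betw_def graph by (simp add: inj_on_imageI image_image)
qed

lemma bij_betw_graph: "bij_betw graph (S n) (perm_graphs n)"
  unfolding bij_betw_def
proof
  show "inj_on graph (S n)"
  proof (rule inj_onI)
    fix \<pi> \<sigma> assume S: "\<pi> \<in> S n" "\<sigma> \<in> S n" and eq: "graph \<pi> = graph \<sigma>"
    show "\<pi> = \<sigma>"
    proof (rule nth_equalityI)
      fix i assume "i < length \<pi>"
      then have "(Suc i, entry \<pi> (Suc i)) \<in> graph \<sigma>"
        unfolding eq[symmetric] by (simp add: graph_def)
      then show "\<pi> ! i = \<sigma> ! i" by (auto simp: graph_def entry_def)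
    qed (simp add: length_S[OF S(1)] length_S[OF S(2)])
  qed
  show "graph ` S n = perm_graphs n"
  proof
    show "perm_graphs n \<subseteq> graph ` S n"
    proof
      fix P assume P: "P \<in> perm_graphs n"
      then have bij: "bij_betw fst P {1..n}" "bij_betw snd P {1..n}"
        by (auto simp: perm_graphs_def)
      \<comment> \<open>For surjectivity, the values of \<open>P\<close> are read off column by
        column to form the list.\<close>
      define h where "h = snd \<circ> inv_into P fst"
      have h: "bij_betw h {1..n} {1..n}"
        unfolding h_def by (rule bij_betw_trans[OF bij_betw_inv_into[OF bij(1)] bij(2)])
      have h_iff: "(i, h i) \<in> P" if "i \<in> {1..n}" for i
      proof -
        have "inv_into P fst i \<in> P" "fst (inv_into P fst i) = i"
          using that bij(1) bij_betw_inv_into_right[OF bij(1) that] 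
            bij_betw_apply[OF bij_betw_inv_into[OF bij(1)] that] by auto
        then show ?thesis by (metis h_def comp_apply prod.collapse)
      qed
      define \<pi> where "\<pi> = map h [1..<Suc n]"
      have "set \<pi> = h ` {1..n}" unfolding \<pi>_def by (simp add: atLeastLessThanSuc_atLeastAtMost del: upt_Suc)
      moreover have "distinct \<pi>"
        unfolding \<pi>_def distinct_map using h
        by (simp add: atLeastLessThanSuc_atLeastAtMost bij_betw_def del: upt_Suc)
      ultimately have "\<pi> \<in> S n" using h by (simp add: S_iff bij_betw_def)
      have "entry \<pi> i = h i" if "i \<in> {1..n}" for i
        using that unfolding \<pi>_def entry_def by (cases i) (simp_all del: upt_Suc)
      then have "graph \<pi> = (\<lambda>i. (i, h i)) ` {1..n}"
        using length_S[OF \<open>\<pi> \<in> S n\<close>] by (simp add: graph_def)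
      also have "\<dots> = P"
      proof
        show "P \<subseteq> (\<lambda>i. (i, h i)) ` {1..n}"
        proof
          fix z assume "z \<in> P"
          moreover from this have i: "fst z \<in> {1..n}" using bij(1) by (auto simp: bij_betw_def)
          ultimately have "snd z = h (fst z)"
            using perm_graphs_eq[OF P, of "fst z" "snd z" "fst z" "h (fst z)"] h_iff by simp
          then show "z \<in> (\<lambda>i. (i, h i)) ` {1..n}" 
            using i by (intro image_eqI[of _ _ "fst z"]) (simp_all add: prod_eq_iff)
        qed
      qed (use h_iff in auto)
      finally show "P \<in> graph ` S n" using \<open>\<pi> \<in> S n\<close> by blast
    qed
  qed (use graph_in_perm_graphs in auto)
qed

text \<open>Lying between the consecutive lines \<open>a\<close> and \<open>a + 1\<close> means
  having exactly \<open>a\<close> lines to the left and being on none; the bounds 0 and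
  \<open>n + 1\<close> are satisfied by every \<open>m\<close> in range. The same statement, read
  for values, serves for rows.\<close>

lemma grid_column:
  fixes p q r a m n :: nat
  assumes "p < q" "q < r" "a \<le> 3" "1 \<le> m" "m \<le> n"
  shows "([0] @ [p, q, r] @ [n + 1]) ! a < m \<and> m < ([0] @ [p, q, r] @ [n + 1]) ! (a + 1) \<longleftrightarrow>
    m \<notin> {p, q, r} \<and> card {x \<in> {p, q, r}. x < m} = a"
proof -
  have "{x \<in> {p, q, r}. x < m} =
    (if m \<le> p then {} else if m \<le> q then {p} else if m \<le> r then {p, q} else {p, q, r})"
    using assms by auto
  then have card: "card {x \<in> {p, q, r}. x < m} =
    (if m \<le> p then 0 else if m \<le> q then 1 else if m \<le> r then 2 else 3)"
    using assms by simp
  consider "a = 0" | "a = 1" | "a = 2" | "a = 3" using assms(3) by linarith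
  then show ?thesis
    unfolding card by cases (use assms in auto)
qed

text \<open>The apex has the least first coordinate, so it must be the leftmost of the three
  points.\<close>

lemma cone_triple:
  assumes "x1 < x2" "x2 < x3" "size2_pattern T"
  shows "cone T {(x1, y1), (x2, y2), (x3, y3)} \<longleftrightarrow> y1 < y2 \<and> y1 < y3 \<and> T {(x2, y2), (x3, y3)}"
proof
  assume "cone T {(x1, y1), (x2, y2), (x3, y3)}"
  then obtain p D where D: "{(x1, y1), (x2, y2), (x3, y3)} = insert p D" "T D"
    and low: "\<forall>z\<in>D. fst p < fst z \<and> snd p < snd z"
    by (auto simp: cone_def)
  have p: "p = (x1, y1)"
  proof (rule ccontr)
    assume "p \<noteq> (x1, y1)"
    moreover have "(x1, y1) \<in> insert p D" "p \<in> {(x1, y1), (x2, y2), (x3, y3)}"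
      using D(1) by blast+
    ultimately show False using low assms by auto
  qed
  have "p \<notin> D" using low by auto
  then have "D = {(x1, y1), (x2, y2), (x3, y3)} - {p}" using D(1) by auto
  also have "\<dots> = {(x2, y2), (x3, y3)}" using assms p by auto
  finally show "y1 < y2 \<and> y1 < y3 \<and> T {(x2, y2), (x3, y3)}"
    using D(2) low p by auto
next
  assume "y1 < y2 \<and> y1 < y3 \<and> T {(x2, y2), (x3, y3)}"
  then show "cone T {(x1, y1), (x2, y2), (x3, y3)}"
    unfolding cone_def using assms
    by (intro exI[of _ "(x1, y1)"] exI[of _ "{(x2, y2), (x3, y3)}"]) auto
qed

lemma order_isomorphic_triple:
  "order_isomorphic [x, y, z] [1, 2, 3] \<longleftrightarrow> x < y \<and> y < z"
  "order_isomorphic [x, y, z] [1, 3, 2] \<longleftrightarrow> x < z \<and> z < y"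
  by (auto simp: order_isomorphic_def All_less_Suc numeral_3_eq_3)

text \<open>\<open>T\<close> is the pattern left after deleting the smallest entry of
  \<open>\<tau>\<close>.\<close>

definition pattern_of :: "nat list \<Rightarrow> ((nat \<times> nat) set \<Rightarrow> bool) \<Rightarrow> bool" where
  "pattern_of \<tau> T \<longleftrightarrow> \<tau> = [1, 2, 3] \<and> T = rising2 \<or> \<tau> = [1, 3, 2] \<and> T = falling2"

lemma order_isomorphic_iff_cone:
  assumes "pattern_of \<tau> T" "x1 < x2" "x2 < x3"
  shows "order_isomorphic [y1, y2, y3] \<tau> \<longleftrightarrow> cone T {(x1, y1), (x2, y2), (x3, y3)}"
proof -
  have "size2_pattern T" using assms(1) by (auto simp: pattern_of_def)
  note c = cone_triple[OF assms(2,3) this]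
  have "card {(x2, y2), (x3, y3)} = 2" using assms by simp
  then have r: "rising2 {(x2, y2), (x3, y3)} \<longleftrightarrow> y2 < y3"
    and f: "falling2 {(x2, y2), (x3, y3)} \<longleftrightarrow> y3 < y2"
    unfolding rising2_def falling2_def using assms by auto
  consider "\<tau> = [1, 2, 3]" "T = rising2" | "\<tau> = [1, 3, 2]" "T = falling2"
    using assms(1) unfolding pattern_of_def by blast
  then show ?thesis
  proof cases
    case 1
    show ?thesis unfolding c unfolding 1 order_isomorphic_triple r by auto
  next
    case 2
    show ?thesis unfolding c unfolding 2 order_isomorphic_triple f by auto
  qed
qed

text \<open>Both sides require three positions. For three, order-isomorphism is the cone condition,
  and \<open>grid_column\<close>, applied to positions and to values, turns the shaded boxes into
  pairs of line counts.\<close>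

lemma is_occurrence_iff_occurs:
  assumes \<pi>: "\<pi> \<in> S n" and \<tau>: "pattern_of \<tau> T" and R: "R \<subseteq> {0..3} \<times> {0..3}" and I: "I \<subseteq> {1..n}"
  shows "is_occurrence (\<tau>, R) \<pi> I \<longleftrightarrow> occurs (cone T) R (graph \<pi>) ((\<lambda>i. (i, entry \<pi> i)) ` I)"
proof -
  define g where "g i = (i, entry \<pi> i)" for i
  have T: "size2_pattern T" using \<tau> by (auto simp: pattern_of_def)
  have fin: "finite I" using I finite_subset by auto
  have inj: "inj_on g A" for A by (auto simp: g_def inj_on_def)
  have n: "length \<pi> = n" using length_S[OF \<pi>] .
  have sub: "g ` I \<subseteq> graph \<pi>" using I by (auto simp: graph_def g_def n)
  have fg: "fst ` g ` I = I" "snd ` g ` I = entry \<pi> ` I"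
    by (auto simp: g_def image_image)
  show ?thesis
  proof (cases "card I = 3")
    case False
    have "length \<tau> = 3" using \<tau> by (auto simp: pattern_of_def)
    then have "\<not> is_occurrence (\<tau>, R) \<pi> I"
      using False fin by (simp add: Let_def order_isomorphic_def)
    moreover have "\<not> cone T (g ` I)"
    proof
      assume "cone T (g ` I)"
      then obtain p D where D: "g ` I = insert p D" "T D" "\<forall>z\<in>D. fst p < fst z \<and> snd p < snd z"
        by (auto simp: cone_def)
      then have "p \<notin> D" "card D = 2" using size2_pattern_card[OF T] by auto
      moreover have "finite D" using D(1) fin by (metis finite_imageI finite_insert)
      ultimately have "card (g ` I) = 3" unfolding D(1) by simp
      then show False using False by (simp add: card_image inj)
    qed
    ultimately show ?thesis by (simp add: occurs_def g_def[abs_def])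
  next
    case True
    obtain x1 x2 x3 where xs: "sorted_list_of_set I = [x1, x2, x3]"
    proof -
      have "length (sorted_list_of_set I) = 3" using True by simp
      then have "\<exists>x1 x2 x3. sorted_list_of_set I = [x1, x2, x3]"
        unfolding numeral_3_eq_3 length_Suc_conv length_0_conv by blast
      then show thesis using that by blast
    qed
    have I3: "I = {x1, x2, x3}" using set_sorted_list_of_set[OF fin] xs by auto
    have lt: "x1 < x2" "x2 < x3"
      using strict_sorted_list_of_set[of I] xs by auto
    define y1 y2 y3 where y: "y1 = entry \<pi> x1" "y2 = entry \<pi> x2" "y3 = entry \<pi> x3"
    have gI: "g ` I = {(x1, y1), (x2, y2), (x3, y3)}" by (simp add: I3 g_def y)
    have iso: "order_isomorphic [y1, y2, y3] \<tau> \<longleftrightarrow> cone T (g ` I)"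
      unfolding gI by (rule order_isomorphic_iff_cone[OF \<tau> lt])
    define vs where "vs = sort [y1, y2, y3]"
    define row col where "row b m \<longleftrightarrow> ([0] @ vs @ [n + 1]) ! b < entry \<pi> m \<and> entry \<pi> m < ([0] @ vs @ [n + 1]) ! (b + 1)"
      and "col a m \<longleftrightarrow> ([0] @ [x1, x2, x3] @ [n + 1]) ! a < m \<and> m < ([0] @ [x1, x2, x3] @ [n + 1]) ! (a + 1)" for a b m
    have occ: "is_occurrence (\<tau>, R) \<pi> I \<longleftrightarrow> order_isomorphic [y1, y2, y3] \<tau> \<and>
        (\<forall>(a, b)\<in>R. \<not> (\<exists>m\<in>{1..n}. col a m \<and> row b m))"
      using I unfolding is_occurrence.simps Let_def n xs col_def row_def vs_def by (simp add: y)
    \<comment> \<open>Order-isomorphism makes the sorted values strictly increasing, so that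
      \<open>grid_column\<close> applies to the rows.\<close>
    have mesh: "(\<forall>(a, b)\<in>R. \<not> (\<exists>m\<in>{1..n}. col a m \<and> row b m)) \<longleftrightarrow> clear R I (entry \<pi> ` I) (graph \<pi>)"
      if iso3: "order_isomorphic [y1, y2, y3] \<tau>"
    proof -
      obtain v1 v2 v3 where v: "vs = [v1, v2, v3]" "v1 < v2" "v2 < v3" "{v1, v2, v3} = {y1, y2, y3}"
      proof (cases "\<tau> = [1, 2, 3]")
        case True
        then have "y1 < y2" "y2 < y3" using iso3 unfolding True order_isomorphic_triple by auto
        then show thesis using that[of y1 y2 y3] by (simp add: vs_def)
      next
        case False
        then have "\<tau> = [1, 3, 2]" using \<tau> unfolding pattern_of_def by blast
        then have "y1 < y3" "y3 < y2" using iso3 unfolding \<open>\<tau> = [1, 3, 2]\<close> order_isomorphic_triple by auto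
        then show thesis using that[of y1 y3 y2] by (auto simp add: vs_def)
      qed
      have eI: "entry \<pi> ` I = {v1, v2, v3}" unfolding v(4) by (simp add: I3 y)
      have cell: "col a m \<and> row b m \<longleftrightarrow> m \<notin> I \<and> entry \<pi> m \<notin> entry \<pi> ` I \<and>
          card {x \<in> I. x < m} = a \<and> card {v \<in> entry \<pi> ` I. v < entry \<pi> m} = b"
        if "(a, b) \<in> R" "m \<in> {1..n}" for a b m
      proof -
        have ab: "a \<le> 3" "b \<le> 3" using that R by auto
        have m: "1 \<le> m" "m \<le> n" "1 \<le> entry \<pi> m" "entry \<pi> m \<le> n"
          using that bij_betw_apply[OF bij_betw_entry[OF \<pi>] that(2)] by auto
        show ?thesis
          unfolding col_def row_def v(1) eI grid_column[OF lt ab(1) m(1,2)]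
            grid_column[OF v(2,3) ab(2) m(3,4)] unfolding I3 by blast
      qed
      have "(\<exists>(a, b)\<in>R. \<exists>m\<in>{1..n}. col a m \<and> row b m) \<longleftrightarrow>
          (\<exists>m\<in>{1..n}. m \<notin> I \<and> entry \<pi> m \<notin> entry \<pi> ` I \<and>
            (card {x \<in> I. x < m}, card {v \<in> entry \<pi> ` I. v < entry \<pi> m}) \<in> R)"
        using cell by blast
      then show ?thesis
        unfolding clear_def graph_def n by simp blast
    qed
    show ?thesis
      using occ iso mesh sub fg unfolding occurs_def g_def[abs_def] by auto
  qed
qed

section \<open>Transfer of the counts from lists to point sets\<close>

lemma num_occurrences_eq:
  assumes \<pi>: "\<pi> \<in> S n" and \<tau>: "pattern_of \<tau> T" and R: "R \<subseteq> {0..3} \<times> {0..3}"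
  shows "num_occurrences (\<tau>, R) \<pi> = occ_count (cone T) R (graph \<pi>)"
proof -
  let ?g = "\<lambda>i. (i, entry \<pi> i)"
  have n: "length \<pi> = n" using length_S[OF \<pi>] .
  have sub: "I \<subseteq> {1..n}" if "is_occurrence (\<tau>, R) \<pi> I" for I
    using that by (simp add: Let_def n)
  \<comment> \<open>Every set of graph points comes from a set of positions, and a point determines
    its position.\<close>
  have "{C. occurs (cone T) R (graph \<pi>) C} = image ?g ` {I. is_occurrence (\<tau>, R) \<pi> I}"
  proof (intro set_eqI iffI)
    fix C assume C: "C \<in> {C. occurs (cone T) R (graph \<pi>) C}"
    then have "C \<subseteq> ?g ` {1..n}" by (simp add: occurs_def graph_def n)
    then obtain I where "I \<subseteq> {1..n}" "C = ?g ` I" by (meson subset_imageE)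
    then show "C \<in> image ?g ` {I. is_occurrence (\<tau>, R) \<pi> I}"
      using C is_occurrence_iff_occurs[OF assms] by blast
  next
    fix C assume "C \<in> image ?g ` {I. is_occurrence (\<tau>, R) \<pi> I}"
    then show "C \<in> {C. occurs (cone T) R (graph \<pi>) C}"
      using is_occurrence_iff_occurs[OF assms sub] by blast
  qed
  moreover have "inj_on (image ?g) M" for M
    by (rule inj_onI) (simp add: inj_image_eq_iff inj_def)
  ultimately show ?thesis
    by (simp add: num_occurrences_def occ_count_def card_image)
qed

lemma joint_count_eq:
  assumes R: "R \<subseteq> {0..3} \<times> {0..3}"
  shows "joint_count ([1, 2, 3], R) ([1, 3, 2], R) n k l = graph_count R n k l"
proof -
  define F where "F P \<longleftrightarrow> occ_count (cone rising2) R P = k \<and> occ_count (cone falling2) R P = l" for P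
  have "num_occurrences ([1, 2, 3], R) \<pi> = occ_count (cone rising2) R (graph \<pi>)"
    "num_occurrences ([1, 3, 2], R) \<pi> = occ_count (cone falling2) R (graph \<pi>)" if "\<pi> \<in> S n" for \<pi>
    using num_occurrences_eq[OF that _ R] by (simp_all add: pattern_of_def)
  then have "joint_count ([1, 2, 3], R) ([1, 3, 2], R) n k l = card {\<pi> \<in> S n. F (graph \<pi>)}"
    unfolding joint_count_def F_def by (intro arg_cong[of _ _ card]) auto
  also have "\<dots> = card (graph ` {\<pi> \<in> S n. F (graph \<pi>)})"
    by (rule card_image[symmetric], rule inj_on_subset[OF bij_betw_imp_inj_on[OF bij_betw_graph]]) auto
  also have "graph ` {\<pi> \<in> S n. F (graph \<pi>)} = {P \<in> graph ` S n. F P}"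
    by blast
  also have "graph ` S n = perm_graphs n"
    by (rule bij_betw_imp_surj_on[OF bij_betw_graph])
  finally show ?thesis by (simp add: graph_count_def F_def)
qed

section \<open>The eight shadings\<close>

lemma graph_count_shading:
  assumes "j \<in> {1..8}"
  shows "graph_count (shading j) n k l = graph_count (lift base_shading) n k l"
proof -
  have base: "base_shading \<subseteq> {0..2} \<times> {0..2}" by (auto simp: base_shading_def)
  have "{0..3::nat} = {0, 1, 2, 3}" by auto
  then have lift: "lift R = {(0, 0), (0, 1), (0, 2), (0, 3)} \<union> map_prod Suc Suc ` R" for R
    by (simp add: lift_def)
  note defs = shading_def lift base_shading_def rotate2_def
  \<comment> \<open>Relative to the base, shadings 2, 3 and 4 arise by reverse-complement, by
    reverse-complement followed by inverse, and by inverse of the upper points; shadings 5 to 8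
    transpose the whole grids of 1 to 4.\<close>
  have 1: "shading 1 = lift base_shading" by (simp add: defs numeral_eq_Suc insert_commute)
  have 2: "shading 2 = lift (rotate2 base_shading)" by (simp add: defs numeral_eq_Suc insert_commute)
  have 3: "shading 3 = lift (prod.swap ` rotate2 base_shading)" by (simp add: defs numeral_eq_Suc insert_commute)
  have 4: "shading 4 = lift (prod.swap ` base_shading)" by (simp add: defs numeral_eq_Suc insert_commute)
  have 5: "shading 5 = prod.swap ` shading 1" by (simp add: shading_def numeral_eq_Suc insert_commute)
  have 6: "shading 6 = prod.swap ` shading 2" by (simp add: shading_def numeral_eq_Suc insert_commute)
  have 7: "shading 7 = prod.swap ` shading 3" by (simp add: shading_def numeral_eq_Suc insert_commute)
  have 8: "shading 8 = prod.swap ` shading 4" by (simp add: shading_def numeral_eq_Suc insert_commute)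
  have "j \<in> {1, 2, 3, 4, 5, 6, 7, 8}" using assms by auto
  then show ?thesis
    by (elim insertE emptyE) (simp_all only: 1 2 3 4 5 6 7 8 graph_count_transpose
        graph_count_transpose2 graph_count_rotate2[OF base])
qed

theorem theorem2p7:
  shows "(\<forall>j\<in>{1..8}. ([1,2,3], shading j) \<sim>\<^sub>j\<^sub>d ([1,3,2], shading j)) \<and>
    (\<forall>i\<in>{1..8}. \<forall>j\<in>{1..8}.
       same_joint_distribution (([1,2,3], shading i), ([1,3,2], shading i))
                               (([1,2,3], shading j), ([1,3,2], shading j)))"
proof -
  have "joint_count ([1,2,3], shading j) ([1,3,2], shading j) n k l = graph_count (lift base_shading) n k l"
    if "j \<in> {1..8}" for j n k l
  proof -
    \<comment> \<open>The length of 123 identifies the size \<open>k\<close> in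
      \<open>mesh_pattern\<close> as 3.\<close>
    have "shading j \<subseteq> {0..3} \<times> {0..3}"
      using mesh_pattern_shading(1)[OF that] length_S[of "[1, 2, 3]"]
      unfolding mesh_pattern_def by fastforce
    then show ?thesis using joint_count_eq graph_count_shading[OF that] by simp
  qed
  then show ?thesis
    unfolding jointly_equidistributed_def same_joint_distribution_def
    using graph_count_base_symmetric by simp
qed

end
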